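(* Let $K$ be an infinite field. Then any effective action of the $n$-dimensional torus $\mathbb{T}^n$ on $K\langle x_1,\dots,x_n\rangle$ is linearizable, that is, it is conjugate to the standard one by an automorphism of $K\langle x_1,\dots,x_n\rangle$.
   Context: $\mathbb{T}^n=(K^* )^n$ is the $n$-dimensional algebraic torus, acting on the free associative algebra $K\langle x_1,\dots,x_n\rangle$ algebraically by $K$-algebra automorphisms. The standard action is $x_i\mapsto\lambda_i x_i$, $i=1,\dots,n$, for $(\lambda_1,\dots,\lambda_n)\in\mathbb{T}^n$. The action is effective if only the identity element of the torus acts trivially.
   Formalization: The action is shown conjugate to x_i ↦ τ(λ)_i x_i with τ an injective algebraic endomorphism of the torus (an automorphism if the action is effective scheme-theoretically), not to the standard action itself: x ↦ λ^{-1}x is effective but not conjugate to x ↦ λx. *)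

theory Defs
  imports Complex_Main "HOL-Library.Poly_Mapping"
begin

section \<open>The free associative algebra\<close>

text \<open>
  The free associative algebra on generators indexed by a type 'n is the monoid algebra of the
  free monoid on 'n. In \<^theory>\<open>HOL-Library.Poly_Mapping\<close> the multiplication of a monoid algebra is
  convolution along an additively written (not necessarily commutative) monoid; therefore
  concatenation of words is written as addition. Lists are wrapped so that this instance
  is not imposed on all lists.
\<close>

datatype 'n free_monoid = Word (letters: "'n list")

instantiation free_monoid :: (type) monoid_add
begin

definition zero_free_monoid :: "'a free_monoid" where
  "0 = Word []"

definition plus_free_monoid :: "'a free_monoid \<Rightarrow> 'a free_monoid \<Rightarrow> 'a free_monoid" where
  "v + w = Word (letters v @ letters w)"

instance
  by standard (simp_all add: zero_free_monoid_def plus_free_monoid_def)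

end

type_synonym ('n, 'k) free_algebra = "'n free_monoid \<Rightarrow>\<^sub>0 'k"

definition const :: "'k \<Rightarrow> ('n, 'k::field) free_algebra" where
  "const c = Poly_Mapping.single 0 c"

definition var :: "'n \<Rightarrow> ('n, 'k::field) free_algebra" where
  "var i = Poly_Mapping.single (Word [i]) 1"

text \<open>A unital ring endomorphism is linear over the field iff it fixes the scalars.\<close>

definition algebra_automorphism ::
    "(('n, 'k::field) free_algebra \<Rightarrow> ('n, 'k) free_algebra) \<Rightarrow> bool" where
  "algebra_automorphism \<phi> \<longleftrightarrow>
     (\<forall>p q. \<phi> (p + q) = \<phi> p + \<phi> q) \<and>
     (\<forall>p q. \<phi> (p * q) = \<phi> p * \<phi> q) \<and>
     (\<forall>c. \<phi> (const c) = const c) \<and>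
     bij \<phi>"

text \<open>The algebra endomorphism sending each generator \<open>var i\<close> to \<open>g i\<close>.\<close>

definition substitute ::
    "('n \<Rightarrow> ('n, 'k::field) free_algebra) \<Rightarrow> ('n, 'k) free_algebra \<Rightarrow> ('n, 'k) free_algebra" where
  "substitute g p =
     (\<Sum>w\<in>Poly_Mapping.keys p. const (Poly_Mapping.lookup p w) * prod_list (map g (letters w)))"


section \<open>The algebraic torus\<close>

text \<open>The torus of rank equal to the cardinality of 'n, through its points over the field.\<close>

definition torus :: "('n \<Rightarrow> 'k::field) set" where
  "torus = {t. \<forall>i. t i \<noteq> 0}"

text \<open>
  Regular functions on the torus are those given by Laurent polynomials. Over an infinite field
  a Laurent polynomial is determined by the function it defines, so this is the coordinate ring.
\<close>

definition regular :: "(('n::finite \<Rightarrow> 'k::field) \<Rightarrow> 'k) \<Rightarrow> bool" where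
  "regular f \<longleftrightarrow>
     (\<exists>(A :: ('n \<Rightarrow> int) set) c. finite A \<and>
        (\<forall>t\<in>torus. f t = (\<Sum>a\<in>A. c a * (\<Prod>i\<in>UNIV. t i powi a i))))"

text \<open>Endomorphisms and automorphisms of the torus as an algebraic group.\<close>

definition torus_endomorphism :: "(('n::finite \<Rightarrow> 'k::field) \<Rightarrow> ('n \<Rightarrow> 'k)) \<Rightarrow> bool" where
  "torus_endomorphism \<tau> \<longleftrightarrow>
     (\<forall>t\<in>torus. \<tau> t \<in> torus) \<and>
     (\<forall>s\<in>torus. \<forall>t\<in>torus. \<tau> (\<lambda>i. s i * t i) = (\<lambda>i. \<tau> s i * \<tau> t i)) \<and>
     (\<forall>i. regular (\<lambda>t. \<tau> t i))"

definition torus_automorphism :: "(('n::finite \<Rightarrow> 'k::field) \<Rightarrow> ('n \<Rightarrow> 'k)) \<Rightarrow> bool" where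
  "torus_automorphism \<tau> \<longleftrightarrow>
     torus_endomorphism \<tau> \<and>
     (\<exists>\<tau>'. torus_endomorphism \<tau>' \<and> (\<forall>t\<in>torus. \<tau>' (\<tau> t) = t \<and> \<tau> (\<tau>' t) = t))"


section \<open>Torus actions\<close>

text \<open>
  The last conjunct says that the action is algebraic, i.e. comes from a coaction of the
  coordinate ring of the torus: the words occurring in \<open>\<sigma> t p\<close> stay in a finite set
  independent of \<open>t\<close>, and their coefficients are regular in \<open>t\<close>. Values of \<open>\<sigma>\<close> outside the
  torus are irrelevant.
\<close>

definition algebraic_torus_action ::
    "(('n::finite \<Rightarrow> 'k::field) \<Rightarrow> ('n, 'k) free_algebra \<Rightarrow> ('n, 'k) free_algebra) \<Rightarrow> bool" where
  "algebraic_torus_action \<sigma> \<longleftrightarrow>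
     (\<forall>t\<in>torus. algebra_automorphism (\<sigma> t)) \<and>
     \<sigma> (\<lambda>i. 1) = id \<and>
     (\<forall>s\<in>torus. \<forall>t\<in>torus. \<sigma> (\<lambda>i. s i * t i) = \<sigma> s \<circ> \<sigma> t) \<and>
     (\<forall>p. \<exists>W. finite W \<and> (\<forall>t\<in>torus. Poly_Mapping.keys (\<sigma> t p) \<subseteq> W) \<and>
        (\<forall>w\<in>W. regular (\<lambda>t. Poly_Mapping.lookup (\<sigma> t p) w)))"

definition effective ::
    "(('n::finite \<Rightarrow> 'k::field) \<Rightarrow> ('n, 'k) free_algebra \<Rightarrow> ('n, 'k) free_algebra) \<Rightarrow> bool" where
  "effective \<sigma> \<longleftrightarrow> (\<forall>t\<in>torus. \<sigma> t = id \<longrightarrow> t = (\<lambda>i. 1))"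

text \<open>
  Triviality of the kernel as a group scheme. The kernel is cut out by the ideal of the
  coordinate ring generated by the functions \<open>t \<mapsto> [w] (\<sigma> t (var i)) - [w] (var i)\<close>, where
  \<open>[w]\<close> denotes the coefficient of the word \<open>w\<close>; it is trivial iff this ideal contains all
  functions \<open>t \<mapsto> t j - 1\<close>. This implies effectiveness, but not conversely: on one generator,
  \<open>var i \<mapsto> t^m var i\<close> is effective whenever the field has no nontrivial \<open>m\<close>-th root of unity
  (\<open>m = 3\<close> over the reals, \<open>m = p\<close> in characteristic \<open>p\<close>), but scheme-theoretically only for
  \<open>m = 1\<close> or \<open>m = -1\<close>.
\<close>

definition scheme_effective ::
    "(('n::finite \<Rightarrow> 'k::field) \<Rightarrow> ('n, 'k) free_algebra \<Rightarrow> ('n, 'k) free_algebra) \<Rightarrow> bool" where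
  "scheme_effective \<sigma> \<longleftrightarrow>
     (\<forall>j. \<exists>(S :: ('n \<times> 'n free_monoid) set) h. finite S \<and> (\<forall>i w. regular (h i w)) \<and>
        (\<forall>t\<in>torus. t j - 1 =
           (\<Sum>(i, w)\<in>S. h i w t *
              (Poly_Mapping.lookup (\<sigma> t (var i)) w - Poly_Mapping.lookup (var i) w))))"

definition standard_action ::
    "('n \<Rightarrow> 'k::field) \<Rightarrow> ('n, 'k) free_algebra \<Rightarrow> ('n, 'k) free_algebra" where
  "standard_action t = substitute (\<lambda>i. const (t i) * var i)"

end

theory Submission
  imports Defs "HOL-Analysis.Cartesian_Space" "HOL-Computational_Algebra.Polynomial"
begin

text \<open>
  The algebra is the direct sum of its weight spaces. Evaluation at points of \<open>K\<^sup>n\<close> lets the torus act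
  on \<open>K\<^sup>n\<close> and on polynomial functions. Effectiveness forces the weights of nonzero functions to have
  rank \<open>n\<close>, so by counting dimensions every invariant function is constant. Then a function of nonzero
  weight never divides a nonzero constant, hence evaluating the component of weight zero is an
  invariant character of the algebra, that is, a fixed point, which may be moved to the origin. Weight
  vectors \<open>y\<^sub>i\<close> whose linear parts form a basis may be normalized to \<open>y\<^sub>i = x\<^sub>i +\<close> higher terms by a
  linear change of coordinates. Their weights are independent, again by effectiveness, so each weight
  space of power series in the \<open>y\<^sub>i\<close> is spanned by finitely many words in them; therefore
  \<open>x\<^sub>i \<mapsto> y\<^sub>i\<close> is an automorphism.
\<close>

section \<open>Homomorphisms out of the free algebra\<close>

text \<open>Effectiveness concerns only the points over \<open>K\<close>, and \<open>K\<close> need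
  not be algebraically closed. Hence the weights of the new coordinates have rank \<open>n\<close>
  but may generate a proper subgroup of the character lattice. This is why the conjugacy involves a
  twist \<open>\<tau>\<close> that is in general only an injective endomorphism; scheme-theoretic
  effectiveness makes the weights a basis of the lattice and \<open>\<tau>\<close> an automorphism.
  Evaluation forgets commutators, so functions alone cannot show that an automorphism is the
  identity. Two facts bridge the gap: an element vanishing at all points has no words of length
  below 2, and a torus element acting trivially to first order acts trivially. Independence of
  weights is proved twice: for functions, before any fixed point is known, and for the
  \<open>y_i\<close>, where it bounds the length of the words of a given weight. The fixed point is
  indispensable in between, because only automorphisms fixing the origin respect the filtration by
  order, on which inverting \<open>x_i \<mapsto> y_i\<close> rests.\<close>

lemma lookup_const_mult [simp]: "Poly_Mapping.lookup (const c * p) w = c * Poly_Mapping.lookup p w"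
  unfolding const_def mult_map_scale_conv_mult[symmetric]
  by (simp add: Poly_Mapping.map.rep_eq when_def)

lemma const_add: "const (a + b) = const a + const b"
  by (simp add: const_def single_add)

lemma const_mult: "const (a * b) = const a * const b"
  by (simp add: const_def mult_single)

lemma const_0 [simp]: "const 0 = 0"
  by (simp add: const_def)

lemma const_sum: "const (sum f A) = (\<Sum>x\<in>A. const (f x))"
  by (induction A rule: infinite_finite_induct) (simp_all add: const_add)

lemma const_1 [simp]: "const 1 = 1"
  by (simp add: const_def)

lemma const_diff: "const (a - b) = const a - const b"
  by (simp add: const_def single_diff)

lemma lookup_const: "Poly_Mapping.lookup (const a) w = (if letters w = [] then a else 0)"
  by (cases w) (auto simp: const_def lookup_single zero_free_monoid_def when_def)

lemma sum_single_keys: "p = (\<Sum>w\<in>Poly_Mapping.keys p. Poly_Mapping.single w (Poly_Mapping.lookup p w))"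
proof (rule poly_mapping_eqI)
  fix v
  have "(\<Sum>w\<in>Poly_Mapping.keys p. Poly_Mapping.lookup (Poly_Mapping.single w (Poly_Mapping.lookup p w)) v)
     = (\<Sum>w\<in>Poly_Mapping.keys p. if w = v then Poly_Mapping.lookup p v else 0)"
    by (intro sum.cong) (auto simp: lookup_single)
  also have "\<dots> = Poly_Mapping.lookup p v"
    by (auto simp: in_keys_iff)
  finally show "Poly_Mapping.lookup p v = Poly_Mapping.lookup
      (\<Sum>w\<in>Poly_Mapping.keys p. Poly_Mapping.single w (Poly_Mapping.lookup p w)) v"
    by (simp add: lookup_sum)
qed

lemma single_Word: "Poly_Mapping.single (Word xs) c = const c * prod_list (map var xs)"
proof (induction xs arbitrary: c)
  case Nil
  then show ?case by (simp add: const_def zero_free_monoid_def)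
next
  case (Cons x xs)
  have "Poly_Mapping.single (Word (x # xs)) c = const c * var x * Poly_Mapping.single (Word xs) 1"
    by (simp add: const_def var_def mult_single plus_free_monoid_def zero_free_monoid_def)
  then show ?case
    using Cons[of 1] by (simp add: mult.assoc)
qed

lemma const_commute: "const c * p = p * const c"
proof -
  have "const c * p = (\<Sum>w\<in>Poly_Mapping.keys p. const c * Poly_Mapping.single w (Poly_Mapping.lookup p w))"
    by (subst sum_single_keys[of p]) (simp add: sum_distrib_left)
  also have "\<dots> = (\<Sum>w\<in>Poly_Mapping.keys p. Poly_Mapping.single w (Poly_Mapping.lookup p w) * const c)"
    by (simp add: const_def mult_single mult.commute)
  also have "\<dots> = p * const c"
    by (subst (3) sum_single_keys[of p]) (simp add: sum_distrib_right)
  finally show ?thesis .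
qed

text \<open>The universal property is used for three targets: the free algebra itself, the field
  (points) and univariate polynomials (lines). As a target may be noncommutative, scalars have to be
  central.\<close>

definition central_embedding :: "('k::field \<Rightarrow> 'r::ring_1) \<Rightarrow> bool" where
  "central_embedding \<eta> \<longleftrightarrow> \<eta> 0 = 0 \<and> \<eta> 1 = 1 \<and> (\<forall>a b. \<eta> (a + b) = \<eta> a + \<eta> b) \<and>
     (\<forall>a b. \<eta> (a * b) = \<eta> a * \<eta> b) \<and> (\<forall>a r. \<eta> a * r = r * \<eta> a)"

definition algebra_hom :: "('k::field \<Rightarrow> 'r::ring_1) \<Rightarrow> (('n, 'k) free_algebra \<Rightarrow> 'r) \<Rightarrow> bool" where
  "algebra_hom \<eta> h \<longleftrightarrow> (\<forall>p q. h (p + q) = h p + h q) \<and> (\<forall>p q. h (p * q) = h p * h q) \<and>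
     (\<forall>c. h (const c) = \<eta> c)"

definition free_lift :: "('k::field \<Rightarrow> 'r::ring_1) \<Rightarrow> ('n \<Rightarrow> 'r) \<Rightarrow> ('n, 'k) free_algebra \<Rightarrow> 'r" where
  "free_lift \<eta> g p = (\<Sum>w\<in>Poly_Mapping.keys p. \<eta> (Poly_Mapping.lookup p w) * prod_list (map g (letters w)))"

lemma central_embeddingD:
  assumes "central_embedding \<eta>"
  shows "\<eta> 0 = 0" "\<eta> 1 = 1" "\<eta> (a + b) = \<eta> a + \<eta> b" "\<eta> (a * b) = \<eta> a * \<eta> b"
    "\<eta> a * r = r * \<eta> a"
  using assms unfolding central_embedding_def by blast+

lemma central_embedding_const [simp]: "central_embedding const"
  unfolding central_embedding_def
  by (intro conjI allI const_commute) (simp_all add: const_add const_mult)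

lemma central_embedding_id [simp]: "central_embedding (\<lambda>a. a)"
  by (simp add: central_embedding_def)

lemma central_embedding_poly [simp]: "central_embedding (\<lambda>a. [:a:])"
  by (simp add: central_embedding_def)

lemma algebra_homD:
  assumes "algebra_hom \<eta> h"
  shows "h (p + q) = h p + h q" "h (p * q) = h p * h q" "h (const c) = \<eta> c"
    "h 0 = 0" "h (p - q) = h p - h q"
proof -
  show add: "h (p + q) = h p + h q" and "h (p * q) = h p * h q" "h (const c) = \<eta> c" for p q
    using assms by (auto simp: algebra_hom_def)
  from add[of 0 0] show "h 0 = 0" by simp
  from add[of "p - q" q] show "h (p - q) = h p - h q" by simp
qed

lemma algebra_hom_sum:
  assumes "algebra_hom \<eta> h"
  shows "h (sum f A) = (\<Sum>x\<in>A. h (f x))"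
  by (induction A rule: infinite_finite_induct) (simp_all add: algebra_homD[OF assms])

lemma algebra_hom_prod_list:
  assumes "algebra_hom \<eta> h" "central_embedding \<eta>"
  shows "h (prod_list xs) = prod_list (map h xs)"
proof (induction xs)
  case Nil
  have "h (const 1) = \<eta> 1" by (simp only: algebra_homD[OF assms(1)])
  then show ?case by (simp add: central_embeddingD(2)[OF assms(2)])
qed (simp add: algebra_homD[OF assms(1)])

lemma algebra_hom_single:
  assumes "algebra_hom \<eta> h" "central_embedding \<eta>"
  shows "h (Poly_Mapping.single w c) = \<eta> c * prod_list (map (\<lambda>i. h (var i)) (letters w))"
  using single_Word[of "letters w" c]
  by (simp add: algebra_homD[OF assms(1)] algebra_hom_prod_list[OF assms] o_def)

lemma algebra_hom_eq_free_lift: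
  assumes "algebra_hom \<eta> h" "central_embedding \<eta>"
  shows "h p = free_lift \<eta> (\<lambda>i. h (var i)) p"
  unfolding free_lift_def
  by (subst sum_single_keys[of p]) (simp add: algebra_hom_sum[OF assms(1)] algebra_hom_single[OF assms])

lemma algebra_hom_eqI:
  assumes "algebra_hom \<eta> h" "algebra_hom \<eta> h'" "central_embedding \<eta>" "\<And>i. h (var i) = h' (var i)"
  shows "h = h'"
proof
  fix p
  show "h p = h' p"
    by (simp only: algebra_hom_eq_free_lift[OF assms(1,3), of p] algebra_hom_eq_free_lift[OF assms(2,3), of p]
      assms(4))
qed

lemma free_lift_superset:
  assumes "finite W" "Poly_Mapping.keys p \<subseteq> W" "central_embedding \<eta>"
  shows "free_lift \<eta> g p = (\<Sum>w\<in>W. \<eta> (Poly_Mapping.lookup p w) * prod_list (map g (letters w)))"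
  unfolding free_lift_def using assms(1,2)
  by (intro sum.mono_neutral_left) (auto simp: central_embeddingD(1)[OF assms(3)] in_keys_iff)

lemma free_lift_single:
  assumes "central_embedding \<eta>"
  shows "free_lift \<eta> g (Poly_Mapping.single w c) = \<eta> c * prod_list (map g (letters w))"
  by (simp add: free_lift_superset[OF _ _ assms, of "{w}"])

lemma free_lift_var [simp]:
  assumes "central_embedding \<eta>"
  shows "free_lift \<eta> g (var i) = g i"
  by (simp add: var_def free_lift_single[OF assms] central_embeddingD(2)[OF assms])

lemma free_lift_add:
  assumes "central_embedding \<eta>"
  shows "free_lift \<eta> g (p + q) = free_lift \<eta> g p + free_lift \<eta> g q"
proof -
  let ?W = "Poly_Mapping.keys p \<union> Poly_Mapping.keys q"
  have "Poly_Mapping.keys (p + q) \<subseteq> ?W" by (rule keys_add)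
  then show ?thesis
    by (simp add: free_lift_superset[OF _ _ assms, of ?W] lookup_add central_embeddingD(3)[OF assms]
      distrib_right sum.distrib)
qed

lemma free_lift_sum:
  assumes "central_embedding \<eta>"
  shows "free_lift \<eta> g (sum f A) = (\<Sum>x\<in>A. free_lift \<eta> g (f x))"
  by (induction A rule: infinite_finite_induct)
     (simp_all add: free_lift_add[OF assms], simp_all add: free_lift_def)

lemma algebra_hom_free_lift:
  fixes g :: "'n \<Rightarrow> 'r::ring_1" and \<eta> :: "'k::field \<Rightarrow> 'r"
  assumes "central_embedding \<eta>"
  shows "algebra_hom \<eta> (free_lift \<eta> g)"
  unfolding algebra_hom_def
proof (intro conjI allI)
  fix p q :: "('n, 'k) free_algebra"
  show "free_lift \<eta> g (p + q) = free_lift \<eta> g p + free_lift \<eta> g q"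
    by (rule free_lift_add[OF assms])
  \<comment> \<open>Centrality enters here: the coefficient of the second factor moves past the word
    of the first.\<close>
  have comm: "\<eta> a * \<eta> b * (P * Q) = (\<eta> a * P) * (\<eta> b * Q)" for a b P Q
  proof -
    have "\<eta> a * \<eta> b * (P * Q) = \<eta> a * (\<eta> b * P) * Q"
      by (simp only: mult.assoc)
    also have "\<dots> = (\<eta> a * P) * (\<eta> b * Q)"
      by (simp only: central_embeddingD(5)[OF assms, of b P] mult.assoc)
    finally show ?thesis .
  qed
  have "p * q = (\<Sum>v\<in>Poly_Mapping.keys p. \<Sum>w\<in>Poly_Mapping.keys q.
      Poly_Mapping.single (v + w) (Poly_Mapping.lookup p v * Poly_Mapping.lookup q w))"
    using arg_cong2[OF sum_single_keys[of p] sum_single_keys[of q], of "(*)"]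
    by (simp only: sum_product mult_single)
  also have "free_lift \<eta> g \<dots> = (\<Sum>v\<in>Poly_Mapping.keys p. \<Sum>w\<in>Poly_Mapping.keys q.
      (\<eta> (Poly_Mapping.lookup p v) * prod_list (map g (letters v))) *
      (\<eta> (Poly_Mapping.lookup q w) * prod_list (map g (letters w))))"
    by (simp add: free_lift_sum[OF assms] free_lift_single[OF assms] plus_free_monoid_def
      comm[symmetric] central_embeddingD(4)[OF assms])
  also have "\<dots> = free_lift \<eta> g p * free_lift \<eta> g q"
    by (simp add: free_lift_def sum_product)
  finally show "free_lift \<eta> g (p * q) = free_lift \<eta> g p * free_lift \<eta> g q" .
next
  fix c
  show "free_lift \<eta> g (const c) = \<eta> c"
    by (simp add: const_def free_lift_single[OF assms] zero_free_monoid_def)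
qed

lemma substitute_eq_free_lift: "substitute = free_lift const"
  by (simp add: fun_eq_iff substitute_def free_lift_def)

lemma algebra_hom_substitute: "algebra_hom const (substitute g)"
  by (simp add: substitute_eq_free_lift algebra_hom_free_lift)

lemma substitute_var [simp]: "substitute g (var i) = g i"
  by (simp add: substitute_eq_free_lift)

lemma substitute_single: "substitute g (Poly_Mapping.single w c) = const c * prod_list (map g (letters w))"
  by (simp add: substitute_eq_free_lift free_lift_single)

lemma algebra_automorphism_iff: "algebra_automorphism \<phi> \<longleftrightarrow> algebra_hom const \<phi> \<and> bij \<phi>"
  by (auto simp: algebra_automorphism_def algebra_hom_def)

lemma algebra_hom_comp:
  "algebra_hom \<eta> h \<Longrightarrow> algebra_hom const \<phi> \<Longrightarrow> algebra_hom \<eta> (h \<circ> \<phi>)"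
  by (simp add: algebra_hom_def)

lemma algebra_hom_id: "algebra_hom const id"
  by (simp add: algebra_hom_def)

lemma algebra_automorphism_comp:
  "algebra_automorphism \<phi> \<Longrightarrow> algebra_automorphism \<psi> \<Longrightarrow> algebra_automorphism (\<phi> \<circ> \<psi>)"
  by (auto simp: algebra_automorphism_iff algebra_hom_comp bij_comp)

lemma algebra_automorphism_inv:
  assumes "algebra_automorphism \<phi>"
  shows "algebra_automorphism (inv \<phi>)"
proof -
  have b: "bij \<phi>" and h: "algebra_hom const \<phi>" using assms by (auto simp: algebra_automorphism_iff)
  have *: "inv \<phi> x = y \<longleftrightarrow> x = \<phi> y" for x y
    using b by (metis bij_inv_eq_iff)
  have **: "\<phi> (inv \<phi> x) = x" for x using b by (simp add: bij_is_surj surj_f_inv_f)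
  show ?thesis
    using b by (auto simp: algebra_automorphism_iff algebra_hom_def * ** algebra_homD[OF h] bij_imp_bij_inv)
qed

lemma algebra_hom_const_mult:
  "algebra_hom \<eta> h \<Longrightarrow> h (const c * p) = \<eta> c * h p"
  by (simp add: algebra_homD)

section \<open>Characters of the torus\<close>

definition chr :: "('n::finite \<Rightarrow> 'k::field) \<Rightarrow> ('n \<Rightarrow> int) \<Rightarrow> 'k" where
  "chr t a = (\<Prod>i\<in>UNIV. t i powi a i)"

lemma chr_nonzero: "t \<in> torus \<Longrightarrow> chr t a \<noteq> 0"
  by (auto simp: chr_def torus_def)

lemma chr_mult: "chr (\<lambda>i. s i * t i) a = chr s a * chr t a"
  by (simp add: chr_def power_int_mult_distrib prod.distrib)

lemma chr_one [simp]: "chr (\<lambda>i. 1) a = 1"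
  by (simp add: chr_def)

lemma chr_zero [simp]: "chr t (\<lambda>i. 0) = 1"
  by (simp add: chr_def)

lemma chr_add: "t \<in> torus \<Longrightarrow> chr t (\<lambda>i. a i + b i) = chr t a * chr t b"
  by (simp add: chr_def torus_def power_int_add prod.distrib)

lemma chr_sum:
  assumes "t \<in> torus"
  shows "chr t (\<lambda>j. \<Sum>i\<in>I. a i j) = (\<Prod>i\<in>I. chr t (a i))"
  by (induction I rule: infinite_finite_induct) (simp_all add: chr_add[OF assms])

lemma chr_powi:
  assumes "t \<in> torus"
  shows "chr t (\<lambda>j. m * a j) = chr t a powi m"
proof -
  have "(\<Prod>i\<in>I. x i) powi m = (\<Prod>i\<in>I. x i powi m)" if "finite I" for I :: "'a set" and x :: "'a \<Rightarrow> 'b"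
    using that by (induction I rule: finite_induct) (simp_all add: power_int_mult_distrib)
  then show ?thesis
    by (simp add: chr_def power_int_mult[symmetric] mult.commute)
qed

lemma torus_one [simp]: "(\<lambda>i. 1) \<in> torus"
  by (simp add: torus_def)

lemma torus_mult: "s \<in> torus \<Longrightarrow> t \<in> torus \<Longrightarrow> (\<lambda>i. s i * t i) \<in> torus"
  by (simp add: torus_def)

text \<open>Otherwise every nonzero scalar would be a root of \<open>X ^ n - 1\<close> with
  \<open>n = \<bar>k\<bar>\<close>. This polynomial is nonzero in every characteristic, having the
  value -1 at 0, so it has finitely many roots.\<close>

lemma powi_ne_1:
  assumes "infinite (UNIV :: 'k::field set)" and "k \<noteq> 0"
  shows "\<exists>z::'k. z \<noteq> 0 \<and> z powi k \<noteq> 1"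
proof (rule ccontr)
  assume "\<not> ?thesis"
  then have *: "z powi k = 1" if "z \<noteq> 0" for z :: 'k using that by auto
  define n where "n = nat \<bar>k\<bar>"
  have n: "n > 0" using assms(2) by (simp add: n_def)
  have pw: "z ^ n = 1" if "z \<noteq> 0" for z :: 'k
  proof (cases "k > 0")
    case True
    then show ?thesis using *[OF that] by (simp add: n_def power_int_def)
  next
    case False
    then show ?thesis using *[OF that] assms(2) by (simp add: n_def power_int_def power_inverse)
  qed
  define p :: "'k poly" where "p = monom 1 n - 1"
  have "poly p 0 = -1" using n by (simp add: p_def poly_monom)
  then have "p \<noteq> 0" by auto
  then have "finite {x. poly p x = 0}" by (rule poly_roots_finite)
  moreover have "UNIV - {0} \<subseteq> {x. poly p x = 0}" by (auto simp: p_def poly_monom pw)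
  ultimately show False using assms(1) by (meson finite_subset finite_Diff2 finite.emptyI finite.insertI)
qed

text \<open>On the elements that are 1 outside a coordinate where the exponents differ, both
  characters are powers of a single scalar.\<close>

lemma chr_separates:
  assumes "infinite (UNIV :: 'k::field set)" and "a \<noteq> b"
  shows "\<exists>s::'n::finite \<Rightarrow> 'k. s \<in> torus \<and> chr s a \<noteq> chr s b"
proof -
  from assms(2) obtain i where i: "a i \<noteq> b i" by auto
  obtain z :: 'k where z: "z \<noteq> 0" "z powi (a i - b i) \<noteq> 1"
    using powi_ne_1[OF assms(1), of "a i - b i"] i by auto
  define s :: "'n \<Rightarrow> 'k" where "s = (\<lambda>j. if j = i then z else 1)"
  have "chr s c = z powi c i" for c
  proof -
    have "chr s c = (\<Prod>j\<in>UNIV. if j = i then z powi c i else 1)"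
      unfolding chr_def by (rule prod.cong) (auto simp: s_def)
    then show ?thesis by simp
  qed
  moreover have "z powi a i \<noteq> z powi b i"
    using z by (auto simp: power_int_diff)
  ultimately show ?thesis
    using z by (intro exI[of _ s]) (auto simp: torus_def s_def)
qed

text \<open>Artin's argument for the independence of characters.\<close>

lemma chr_independent:
  fixes c :: "('n::finite \<Rightarrow> int) \<Rightarrow> 'k::field"
  assumes "infinite (UNIV :: 'k set)" and "finite A"
    and "\<And>t. t \<in> torus \<Longrightarrow> (\<Sum>a\<in>A. c a * chr t a) = 0" and "a \<in> A"
  shows "c a = 0"
  using assms(2,3,4)
proof (induction A arbitrary: c a rule: finite_induct)
  case empty
  then show ?case by simp
next
  case (insert b A)
  have A: "c a = 0" if "a \<in> A" for a
  proof -
    from that insert(2) obtain s :: "'n \<Rightarrow> 'k" where s: "s \<in> torus" "chr s a \<noteq> chr s b"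
      using chr_separates[OF assms(1), of a b] by auto
    have "(\<Sum>a\<in>A. (c a * (chr s a - chr s b)) * chr t a) = 0" if "t \<in> torus" for t
    proof -
      have "(\<Sum>a\<in>insert b A. c a * chr (\<lambda>i. s i * t i) a) = 0"
        by (rule insert.prems) (use s that in \<open>simp add: torus_mult\<close>)
      moreover have "chr s b * (\<Sum>a\<in>insert b A. c a * chr t a) = 0"
        using insert.prems(1)[OF that] by simp
      ultimately have "(\<Sum>a\<in>insert b A. (c a * (chr s a - chr s b)) * chr t a) = 0"
        by (simp add: chr_mult algebra_simps sum_distrib_left sum_subtractf)
      then show ?thesis using insert(1,2) by simp
    qed
    from insert.IH[OF this \<open>a \<in> A\<close>] s show ?thesis by simp
  qed
  moreover have "c b = 0"
    using insert.prems(1)[OF torus_one] insert(1,2) A by simp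
  ultimately show ?case using insert.prems(2) by auto
qed

section \<open>Linear algebra\<close>

text \<open>Gaussian elimination: a pivot \<open>x0\<close> allows the equation \<open>y0\<close> to
  be solved for the unknown \<open>a x0\<close>. Arbitrary finite index sets are allowed because the
  unknowns will be indexed by exponents of products and the equations by monomials.\<close>

lemma homogeneous_system_nontrivial:
  fixes C :: "'x \<Rightarrow> 'y \<Rightarrow> 'k::field"
  assumes "finite Y" "finite X" "card Y < card X"
  shows "\<exists>a. (\<exists>x\<in>X. a x \<noteq> 0) \<and> (\<forall>y\<in>Y. (\<Sum>x\<in>X. a x * C x y) = 0)"
  using assms
proof (induction Y arbitrary: X C rule: finite_induct)
  case empty
  then obtain x where "x \<in> X" by fastforce
  then show ?case by (intro exI[of _ "\<lambda>_. 1"]) auto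
next
  case (insert y0 Y)
  show ?case
  proof (cases "\<forall>x\<in>X. C x y0 = 0")
    case True
    have "card Y < card X" using insert by simp
    from insert.IH[OF insert.prems(1) this] obtain a where
      "\<exists>x\<in>X. a x \<noteq> 0" "\<forall>y\<in>Y. (\<Sum>x\<in>X. a x * C x y) = 0" by blast
    with True show ?thesis by (intro exI[of _ a]) auto
  next
    case False
    then obtain x0 where x0: "x0 \<in> X" "C x0 y0 \<noteq> 0" by blast
    define X' where "X' = X - {x0}"
    have X': "X = insert x0 X'" "x0 \<notin> X'" "finite X'"
      using x0 insert.prems by (auto simp: X'_def)
    have "card Y < card X'" using insert X' by simp
    from insert.IH[OF X'(3) this, of "\<lambda>x y. C x y - C x y0 / C x0 y0 * C x0 y"] obtain a where
      a: "\<exists>x\<in>X'. a x \<noteq> 0" "\<forall>y\<in>Y. (\<Sum>x\<in>X'. a x * (C x y - C x y0 / C x0 y0 * C x0 y)) = 0"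
      by blast
    define b where "b = a(x0 := - (\<Sum>x\<in>X'. a x * C x y0) / C x0 y0)"
    have b: "(\<Sum>x\<in>X. b x * C x y) = b x0 * C x0 y + (\<Sum>x\<in>X'. a x * C x y)" for y
    proof -
      have "(\<Sum>x\<in>X'. b x * C x y) = (\<Sum>x\<in>X'. a x * C x y)"
        by (rule sum.cong) (use X' in \<open>auto simp: b_def\<close>)
      then show ?thesis using X' by simp
    qed
    have "(\<Sum>x\<in>X. b x * C x y0) = 0"
      using x0 by (simp add: b) (simp add: b_def)
    moreover have "(\<Sum>x\<in>X. b x * C x y) = 0" if "y \<in> Y" for y
    proof -
      have "0 = (\<Sum>x\<in>X'. a x * (C x y - C x y0 / C x0 y0 * C x0 y))"
        using a that by simp
      also have "\<dots> = (\<Sum>x\<in>X'. a x * C x y - a x * C x y0 * (C x0 y / C x0 y0))"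
        by (intro sum.cong refl) (simp add: right_diff_distrib)
      also have "\<dots> = (\<Sum>x\<in>X'. a x * C x y) - (\<Sum>x\<in>X'. a x * C x y0) * (C x0 y / C x0 y0)"
        by (simp only: sum_subtractf sum_distrib_right)
      also have "\<dots> = (\<Sum>x\<in>X. b x * C x y)"
        by (simp add: b) (simp add: b_def)
      finally show ?thesis by simp
    qed
    moreover have "\<exists>x\<in>X. b x \<noteq> 0"
      using a(1) X' by (auto simp: b_def)
    ultimately show ?thesis by blast
  qed
qed

text \<open>A basis extracted from the spanning set is listed as the rows of a square matrix;
  spanning rows give a left inverse, which is two-sided. It will be applied to the linear parts of
  weight vectors.\<close>

lemma spanning_set_invertible_matrix:
  fixes S :: "('a::field ^ 'n) set"
  assumes "vec.span S = UNIV"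
  shows "\<exists>(r :: 'n \<Rightarrow> 'a ^ 'n) B. (\<forall>i. r i \<in> S) \<and> B ** (\<chi> i. r i) = mat 1 \<and> (\<chi> i. r i) ** B = mat 1"
proof -
  obtain B where B: "B \<subseteq> S" "vec.independent B" "S \<subseteq> vec.span B"
    using vec.maximal_independent_subset by blast
  have sp: "vec.span B = UNIV"
    using assms B(3) by (metis vec.span_mono vec.span_span top.extremum_uniqueI)
  have "card B = CARD('n)"
    using vec.dim_eq_card[of B UNIV] B(2) sp by (simp add: vec.dim_UNIV card_cart_basis)
  moreover have "finite B"
    using B(2) vec.finiteI_independent by blast
  ultimately obtain h where h: "bij_betw h (UNIV :: 'n set) B"
    using finite_same_card_bij[of "UNIV :: 'n set" B] by auto
  have "rows (\<chi> i. h i) = B"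
    using h by (auto simp: rows_def row_def bij_betw_def)
  then obtain M where M: "M ** (\<chi> i. h i) = mat 1"
    using sp matrix_left_invertible_span_rows_gen[of "\<chi> i. h i"] by auto
  with matrix_left_right_inverse have "(\<chi> i. h i) ** M = mat 1" by blast
  moreover have "h i \<in> S" for i using h B(1) by (auto simp: bij_betw_def)
  ultimately have "(\<forall>i. h i \<in> S) \<and> M ** (\<chi> i. h i) = mat 1 \<and> (\<chi> i. h i) ** M = mat 1"
    using M by simp
  then show ?thesis by (intro exI)
qed

text \<open>This is full rank, not unimodularity: the rows may generate a proper subgroup of the
  lattice.\<close>

definition int_independent :: "('n::finite \<Rightarrow> 'n \<Rightarrow> int) \<Rightarrow> bool" where
  "int_independent \<omega> \<longleftrightarrow> (\<forall>m. (\<forall>j. (\<Sum>i\<in>UNIV. m i * \<omega> i j) = 0) \<longrightarrow> (\<forall>i. m i = 0))"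

lemma clear_denominators:
  fixes x :: "'n::finite \<Rightarrow> rat"
  shows "\<exists>N z. N > 0 \<and> (\<forall>i. of_int N * x i = of_int (z i))"
proof -
  define N where "N = (\<Prod>i\<in>UNIV. snd (quotient_of (x i)))"
  have pos: "snd (quotient_of (x i)) > 0" for i
    by (rule quotient_of_denom_pos')
  have "\<exists>z. of_int N * x i = of_int z" for i
  proof -
    have "N = snd (quotient_of (x i)) * (\<Prod>i\<in>UNIV - {i}. snd (quotient_of (x i)))"
      unfolding N_def by (subst prod.remove[of _ i]) auto
    moreover have "x i = of_int (fst (quotient_of (x i))) / of_int (snd (quotient_of (x i)))"
      by (metis prod.collapse quotient_of_div)
    moreover have "rat_of_int (snd (quotient_of (x i))) \<noteq> 0"
      using pos[of i] by simp
    ultimately have "of_int N * x i =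
        of_int (fst (quotient_of (x i)) * (\<Prod>i\<in>UNIV - {i}. snd (quotient_of (x i))))"
      by (smt (verit) divide_eq_eq mult.assoc mult.commute of_int_mult)
    then show ?thesis by blast
  qed
  moreover have "N > 0" unfolding N_def using pos by (intro prod_pos) auto
  ultimately show ?thesis by metis
qed

text \<open>Row rank equals column rank. The hypothesis, extended to rational vectors by clearing
  denominators, makes the matrix invertible over the rationals. It has the form in which torus
  elements supply it: \<open>l\<close> will be the exponent of a one-parameter subgroup.\<close>

lemma int_independentI:
  fixes \<omega> :: "'n::finite \<Rightarrow> 'n \<Rightarrow> int"
  assumes "\<And>l. (\<forall>i. (\<Sum>j\<in>UNIV. l j * \<omega> i j) = 0) \<Longrightarrow> \<forall>j. l j = 0"
  shows "int_independent \<omega>"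
proof -
  define A :: "rat ^ 'n ^ 'n" where "A = (\<chi> i j. of_int (\<omega> i j))"
  have "x = 0" if "A *v x = 0" for x
  proof -
    obtain N z where N: "N > 0" "\<And>i. of_int N * x $ i = of_int (z i)"
      using clear_denominators[of "\<lambda>i. x $ i"] by auto
    have "(\<Sum>j\<in>UNIV. z j * \<omega> i j) = 0" for i
    proof -
      have "of_int (\<Sum>j\<in>UNIV. z j * \<omega> i j) = (\<Sum>j\<in>UNIV. of_int N * (of_int (\<omega> i j) * x $ j))"
        by (simp add: N(2)[symmetric] mult_ac)
      also have "\<dots> = of_int N * (A *v x) $ i"
        by (simp add: sum_distrib_left A_def matrix_vector_mult_def)
      finally have "rat_of_int (\<Sum>j\<in>UNIV. z j * \<omega> i j) = 0" using that by simp
      then show ?thesis by (simp only: of_int_eq_0_iff)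
    qed
    with assms have "\<forall>j. z j = 0" by blast
    then show "x = 0" using N by (simp add: vec_eq_iff)
  qed
  then obtain B where "B ** A = mat 1"
    using matrix_left_invertible_ker[of A] by blast
  then have AB: "A ** B = mat 1" by (simp add: matrix_left_right_inverse)
  show ?thesis
    unfolding int_independent_def
  proof (intro allI impI)
    fix m i assume m: "\<forall>j. (\<Sum>i\<in>UNIV. m i * \<omega> i j) = 0"
    define v :: "rat ^ 'n" where "v = (\<chi> i. of_int (m i))"
    have "(v v* A) $ j = of_int (\<Sum>i\<in>UNIV. m i * \<omega> i j)" for j
      by (simp add: vector_matrix_mult_def v_def A_def mult_ac)
    then have "v v* A = 0" using m by (simp add: vec_eq_iff)
    then have "v v* (A ** B) = 0"
      by (simp add: vector_matrix_mul_assoc[symmetric])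
    then have "v = 0" by (simp add: AB)
    then show "m i = 0" by (simp add: v_def vec_eq_iff)
  qed
qed

text \<open>A vector \<open>l\<close> orthogonal to a maximal rationally independent subset of
  \<open>S\<close> is orthogonal to its span, hence to \<open>S\<close>, hence zero.\<close>

lemma int_independent_subset:
  fixes S :: "('n::finite \<Rightarrow> int) set"
  assumes "\<And>l. (\<forall>a\<in>S. (\<Sum>j\<in>UNIV. l j * a j) = 0) \<Longrightarrow> \<forall>j. l j = 0"
  shows "\<exists>\<omega>. range \<omega> \<subseteq> S \<and> int_independent \<omega>"
proof -
  define \<iota> :: "('n \<Rightarrow> int) \<Rightarrow> rat ^ 'n" where "\<iota> a = (\<chi> j. of_int (a j))" for a
  obtain B where B: "B \<subseteq> \<iota> ` S" "vec.independent B" "\<iota> ` S \<subseteq> vec.span B"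
    using vec.maximal_independent_subset by blast
  have fin: "finite B"
    using B(2) vec.finiteI_independent by blast
  have "card B \<le> CARD('n)"
    using vec.independent_card_le_dim[of B UNIV] B(2) by (simp add: vec.dim_UNIV card_cart_basis)
  from card_le_inj[OF fin finite_class.finite_UNIV this] obtain h :: "rat ^ 'n \<Rightarrow> 'n" where h: "inj_on h B"
    by (elim exE conjE)
  obtain g where g: "\<And>v. v \<in> B \<Longrightarrow> g v \<in> S \<and> \<iota> (g v) = v"
  proof -
    have "\<forall>v\<in>B. \<exists>a. a \<in> S \<and> \<iota> a = v" using B(1) by blast
    from bchoice[OF this] show ?thesis using that by blast
  qed
  \<comment> \<open>The basis could have fewer than \<open>n\<close> elements, so missing rows are
    padded with zero. Once independence is shown, a zero row is contradictory and no padding has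
    occurred.\<close>
  define \<omega> where "\<omega> i = (if i \<in> h ` B then g (the_inv_into B h i) else (\<lambda>_. 0))" for i
  have \<omega>_h: "\<omega> (h v) = g v" if "v \<in> B" for v
    using that h by (simp add: \<omega>_def the_inv_into_f_f)
  have ind: "int_independent \<omega>"
  proof (rule int_independentI)
    fix l assume l: "\<forall>i. (\<Sum>j\<in>UNIV. l j * \<omega> i j) = 0"
    have "(\<Sum>j\<in>UNIV. of_int (l j) * v $ j) = 0" if "v \<in> vec.span B" for v
      using that
    proof (induction rule: vec.span_induct)
      case base
      then show ?case
        by (auto simp: vec.subspace_def sum.distrib distrib_left sum_distrib_left[symmetric] mult.left_commute)
    next
      case (step v)
      have "(\<Sum>j\<in>UNIV. of_int (l j) * \<iota> (g v) $ j) = of_int (\<Sum>j\<in>UNIV. l j * \<omega> (h v) j)"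
        using \<omega>_h[OF step] by (simp add: \<iota>_def)
      then show ?case using l g[OF step] by simp
    qed
    then have "(\<Sum>j\<in>UNIV. of_int (l j) * \<iota> a $ j) = 0" if "a \<in> S" for a
      using that B(3) by auto
    then have "rat_of_int (\<Sum>j\<in>UNIV. l j * a j) = 0" if "a \<in> S" for a
      using that by (simp add: \<iota>_def)
    then have "(\<Sum>j\<in>UNIV. l j * a j) = 0" if "a \<in> S" for a
      using that by (simp only: of_int_eq_0_iff)
    then show "\<forall>j. l j = 0" using assms by blast
  qed
  have "\<omega> i \<in> S" for i
  proof (cases "i \<in> h ` B")
    case True
    then show ?thesis using \<omega>_h g by auto
  next
    case False
    then have "\<omega> i = (\<lambda>_. 0)" by (simp add: \<omega>_def)
    then have "\<forall>j. (\<Sum>k\<in>UNIV. (if k = i then 1 else 0) * \<omega> k j) = 0"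
      by (auto intro!: sum.neutral)
    with ind have "(if i = i then 1 else 0 :: int) = 0"
      unfolding int_independent_def by fast
    then show ?thesis by simp
  qed
  with ind show ?thesis by blast
qed

section \<open>Polynomial functions\<close>

definition evaluate :: "('n \<Rightarrow> 'k::field) \<Rightarrow> ('n, 'k) free_algebra \<Rightarrow> 'k" where
  "evaluate = free_lift (\<lambda>a. a)"

lemma algebra_hom_evaluate: "algebra_hom (\<lambda>a. a) (evaluate c)"
  by (simp add: evaluate_def algebra_hom_free_lift)

lemmas evaluate_simps [simp] = algebra_homD[OF algebra_hom_evaluate]

lemma evaluate_var [simp]: "evaluate c (var i) = c i"
  by (simp add: evaluate_def)

lemma evaluate_one [simp]: "evaluate c 1 = 1"
  using evaluate_simps(3)[of c 1] by simp

lemma evaluate_sum: "evaluate c (sum f A) = (\<Sum>x\<in>A. evaluate c (f x))"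
  by (rule algebra_hom_sum[OF algebra_hom_evaluate])

text \<open>Characters of the free algebra are points of the affine space; the fixed point will be
  constructed as a character.\<close>

lemma algebra_hom_eq_evaluate:
  "algebra_hom (\<lambda>a. a) h \<Longrightarrow> h = evaluate (\<lambda>i. h (var i))"
  by (rule algebra_hom_eqI[OF _ algebra_hom_evaluate]) simp_all

text \<open>Restriction to the line through \<open>c\<close> and \<open>d\<close>, with parameter 0
  at \<open>c\<close> and 1 at \<open>d\<close>. It reduces questions about functions of several
  variables to univariate polynomials, which have no zero divisors and only constant units.\<close>

definition line :: "('n \<Rightarrow> 'k::field) \<Rightarrow> ('n \<Rightarrow> 'k) \<Rightarrow> ('n, 'k) free_algebra \<Rightarrow> 'k poly" where
  "line c d = free_lift (\<lambda>a. [:a:]) (\<lambda>i. [:c i, d i - c i:])"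

lemma algebra_hom_line: "algebra_hom (\<lambda>a. [:a:]) (line c d)"
  by (simp add: line_def algebra_hom_free_lift)

lemma poly_line: "poly (line c d p) z = evaluate (\<lambda>i. c i + z * (d i - c i)) p"
proof -
  have "algebra_hom (\<lambda>a. a) (\<lambda>p. poly (line c d p) z)"
    by (simp add: algebra_hom_def algebra_homD[OF algebra_hom_line])
  then have "(\<lambda>p. poly (line c d p) z) = evaluate (\<lambda>i. poly (line c d (var i)) z)"
    by (rule algebra_hom_eq_evaluate)
  moreover have "line c d (var i) = [:c i, d i - c i:]" for i
    by (simp add: line_def)
  ultimately have "(\<lambda>p. poly (line c d p) z) = evaluate (\<lambda>i. poly [:c i, d i - c i:] z)"
    by (simp only:)
  then show ?thesis by (auto dest: fun_cong)
qed

lemma poly_eqI_infinite: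
  fixes P Q :: "'k::field poly"
  assumes "infinite Z" "\<And>z. z \<in> Z \<Longrightarrow> poly P z = poly Q z"
  shows "P = Q"
proof (rule ccontr)
  assume "P \<noteq> Q"
  then have "finite {z. poly (P - Q) z = 0}" by (intro poly_roots_finite) simp
  moreover have "Z \<subseteq> {z. poly (P - Q) z = 0}" using assms(2) by auto
  ultimately show False using assms(1) finite_subset by blast
qed

text \<open>Restrict to the line joining a point where \<open>p\<close> does not vanish to one where
  \<open>q\<close> does not: the product of two nonzero univariate polynomials would be
  zero.\<close>

lemma evaluate_prod_zero:
  fixes p q :: "('n, 'k::field) free_algebra"
  assumes "infinite (UNIV :: 'k set)" "\<And>c. evaluate c p * evaluate c q = 0"
  shows "(\<forall>c. evaluate c p = 0) \<or> (\<forall>c. evaluate c q = 0)"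
proof (rule ccontr)
  assume "\<not> ?thesis"
  then obtain c d where cd: "evaluate c p \<noteq> 0" "evaluate d q \<noteq> 0" by blast
  have "line c d p * line c d q = 0"
    by (rule poly_eqI_infinite[OF assms(1)]) (simp add: poly_line assms(2))
  then have "line c d p = 0 \<or> line c d q = 0" by simp
  moreover have "poly (line c d p) 0 = evaluate c p" "poly (line c d q) 1 = evaluate d q"
    by (simp_all add: poly_line)
  ultimately show False using cd by auto
qed

text \<open>On the line through \<open>c\<close> and \<open>d\<close> some value is taken infinitely
  often, which forces a univariate polynomial to be constant.\<close>

lemma evaluate_finite_range_constant:
  fixes p :: "('n, 'k::field) free_algebra"
  assumes "infinite (UNIV :: 'k set)" "finite R" "\<And>c. evaluate c p \<in> R"
  shows "evaluate c p = evaluate d p"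
proof -
  let ?P = "line c d p"
  have "finite (range (poly ?P))"
    by (rule finite_subset[OF _ assms(2)]) (auto simp: poly_line assms(3))
  then obtain z0 where "infinite {z \<in> UNIV. poly ?P z = poly ?P z0}"
    using pigeonhole_infinite[OF assms(1)] by blast
  then have "?P = [:poly ?P z0:]" by (rule poly_eqI_infinite) auto
  then have "poly ?P 0 = poly ?P 1" by (metis mult_zero_right poly_0 poly_pCons)
  then show ?thesis by (simp add: poly_line)
qed

text \<open>On each line the restriction of \<open>p\<close> divides a nonzero constant, so it is a
  unit among univariate polynomials, that is, constant.\<close>

lemma evaluate_unit_constant:
  fixes p :: "('n, 'k::field) free_algebra"
  assumes "infinite (UNIV :: 'k set)" "\<And>c. evaluate c p * evaluate c q = r" "r \<noteq> 0"
  shows "evaluate c p = evaluate d p"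
proof -
  let ?P = "line c d p" and ?Q = "line c d q"
  have eq: "?P * ?Q = [:r:]"
    by (rule poly_eqI_infinite[OF assms(1)]) (simp add: poly_line assms(2))
  have "is_unit (?P * ?Q)"
    using assms(3) by (simp add: eq is_unit_const_poly_iff dvd_field_iff)
  then have "is_unit ?P" by (rule is_unit_mult_iff[THEN iffD1, THEN conjunct1])
  then obtain x where "?P = [:x:]" by (auto simp: is_unit_poly_iff)
  then have "poly ?P 0 = poly ?P 1" by simp
  then show ?thesis by (simp add: poly_line)
qed

section \<open>Polynomial functions of bounded degree\<close>

definition polyfun :: "nat \<Rightarrow> (('n \<Rightarrow> 'k::field) \<Rightarrow> 'k) \<Rightarrow> bool" where
  "polyfun N g \<longleftrightarrow> (\<exists>p. (\<forall>w\<in>Poly_Mapping.keys p. length (letters w) \<le> N) \<and> g = (\<lambda>c. evaluate c p))"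

lemma polyfun_mono: "polyfun N g \<Longrightarrow> N \<le> M \<Longrightarrow> polyfun M g"
  unfolding polyfun_def by fastforce

lemma polyfun_evaluate: "\<exists>N. polyfun N (\<lambda>c. evaluate c p)"
proof -
  have "length (letters w) \<le> Max ((\<lambda>w. length (letters w)) ` Poly_Mapping.keys p)"
    if "w \<in> Poly_Mapping.keys p" for w
    using that by (intro Max_ge) auto
  then show ?thesis unfolding polyfun_def by blast
qed

lemma polyfun_one: "polyfun 0 (\<lambda>c. 1)"
  unfolding polyfun_def by (intro exI[of _ 1]) (auto simp: zero_free_monoid_def)

lemma polyfun_mult:
  assumes "polyfun N g" "polyfun M h"
  shows "polyfun (N + M) (\<lambda>c. g c * h c)"
proof -
  obtain p q where p: "\<And>w. w \<in> Poly_Mapping.keys p \<Longrightarrow> length (letters w) \<le> N" "g = (\<lambda>c. evaluate c p)"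
    and q: "\<And>w. w \<in> Poly_Mapping.keys q \<Longrightarrow> length (letters w) \<le> M" "h = (\<lambda>c. evaluate c q)"
    using assms unfolding polyfun_def by blast
  have "length (letters w) \<le> N + M" if "w \<in> Poly_Mapping.keys (p * q)" for w
    using subsetD[OF keys_mult that] p(1) q(1) by (fastforce simp: plus_free_monoid_def)
  then show ?thesis
    unfolding polyfun_def p(2) q(2) by (intro exI[of _ "p * q"]) simp
qed

lemma polyfun_power: "polyfun N g \<Longrightarrow> polyfun (k * N) (\<lambda>c. g c ^ k)"
  by (induction k) (auto simp: polyfun_one intro: polyfun_mult)

lemma polyfun_prod:
  "finite I \<Longrightarrow> (\<And>i. i \<in> I \<Longrightarrow> polyfun N (g i)) \<Longrightarrow> polyfun (card I * N) (\<lambda>c. \<Prod>i\<in>I. g i c)"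
  by (induction I rule: finite_induct) (auto simp: polyfun_one intro: polyfun_mult)

text \<open>Bounding each exponent separately is coarser than bounding the total degree, but the
  count becomes a plain power, and only its growth in \<open>N\<close> matters.\<close>

definition box :: "nat \<Rightarrow> ('n \<Rightarrow> nat) set" where
  "box N = {\<beta>. \<forall>i. \<beta> i \<le> N}"

lemma box_eq_PiE: "box N = PiE UNIV (\<lambda>_. {..N})"
  by (auto simp: box_def)

lemma finite_box: "finite (box N :: ('n::finite \<Rightarrow> nat) set)"
  unfolding box_eq_PiE by (intro finite_PiE) auto

lemma card_box: "card (box N :: ('n::finite \<Rightarrow> nat) set) = Suc N ^ CARD('n)"
  unfolding box_eq_PiE by (simp add: card_PiE)

lemma prod_list_map_eq_prod:
  fixes c :: "'n::finite \<Rightarrow> 'k::comm_monoid_mult"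
  shows "prod_list (map c xs) = (\<Prod>i\<in>UNIV. c i ^ count_list xs i)"
proof (induction xs)
  case (Cons x xs)
  have "(\<Prod>i\<in>UNIV. c i ^ count_list (x # xs) i) =
      (\<Prod>i\<in>UNIV. (if i = x then c i else 1) * c i ^ count_list xs i)"
    by (intro prod.cong) auto
  then show ?case using Cons by (simp add: prod.distrib)
qed simp

text \<open>Words with the same letter multiplicities define the same function, so their
  coefficients are added up.\<close>

lemma polyfun_monomials:
  assumes "polyfun N (g :: ('n::finite \<Rightarrow> 'k::field) \<Rightarrow> 'k)"
  shows "\<exists>C. \<forall>c. g c = (\<Sum>\<beta>\<in>box N. C \<beta> * (\<Prod>i\<in>UNIV. c i ^ \<beta> i))"
proof -
  obtain p where p: "\<And>w. w \<in> Poly_Mapping.keys p \<Longrightarrow> length (letters w) \<le> N" "g = (\<lambda>c. evaluate c p)"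
    using assms unfolding polyfun_def by blast
  define ct where "ct w = count_list (letters w)" for w :: "'n free_monoid"
  define C where "C \<beta> = (\<Sum>w\<in>{w \<in> Poly_Mapping.keys p. ct w = \<beta>}. Poly_Mapping.lookup p w)" for \<beta>
  have "g c = (\<Sum>\<beta>\<in>box N. C \<beta> * (\<Prod>i\<in>UNIV. c i ^ \<beta> i))" for c
  proof -
    have "g c = (\<Sum>w\<in>Poly_Mapping.keys p. Poly_Mapping.lookup p w * (\<Prod>i\<in>UNIV. c i ^ ct w i))"
      by (simp add: p(2) evaluate_def free_lift_def prod_list_map_eq_prod ct_def)
    also have "\<dots> = (\<Sum>\<beta>\<in>box N. \<Sum>w\<in>{w \<in> Poly_Mapping.keys p. ct w = \<beta>}.
        Poly_Mapping.lookup p w * (\<Prod>i\<in>UNIV. c i ^ ct w i))"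
    proof (rule sum.group[symmetric])
      show "ct ` Poly_Mapping.keys p \<subseteq> box N"
        using p(1) count_le_length by (fastforce simp: box_def ct_def intro: order_trans)
    qed (simp_all add: finite_box)
    also have "\<dots> = (\<Sum>\<beta>\<in>box N. C \<beta> * (\<Prod>i\<in>UNIV. c i ^ \<beta> i))"
      by (simp add: C_def sum_distrib_right)
    finally show ?thesis .
  qed
  then show ?thesis by blast
qed

text \<open>
  Counting: the products of \<open>n + 1\<close> functions with exponents up to \<open>d\<close> number \<open>(d + 1) ^ (n + 1)\<close>,
  but they lie in a space of dimension \<open>O(d ^ n)\<close>.
\<close>

lemma algebraically_dependent:
  fixes y :: "'n::finite \<Rightarrow> ('n, 'k::field) free_algebra"
  shows "\<exists>d a. (\<exists>x\<in>{..d} \<times> box d. a x \<noteq> 0) \<and>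
    (\<forall>c. (\<Sum>(k, \<beta>)\<in>{..d} \<times> box d. a (k, \<beta>) * (evaluate c f ^ k * (\<Prod>i\<in>UNIV. evaluate c (y i) ^ \<beta> i))) = 0)"
proof -
  obtain Df where Df: "polyfun Df (\<lambda>c. evaluate c f)" using polyfun_evaluate by blast
  have "\<forall>i. \<exists>D. polyfun D (\<lambda>c. evaluate c (y i))" using polyfun_evaluate by blast
  then obtain Dy where Dy: "\<And>i. polyfun (Dy i) (\<lambda>c. evaluate c (y i))" by metis
  define D where "D = Df + Max (range Dy)"
  have D: "polyfun D (\<lambda>c. evaluate c f)" "polyfun D (\<lambda>c. evaluate c (y i))" for i
    unfolding D_def by (auto intro: polyfun_mono[OF Df] polyfun_mono[OF Dy] simp: trans_le_add2)
  \<comment> \<open>This \<open>C\<close> gives \<open>Suc N \<le> C * Suc d\<close> whatever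
    \<open>d\<close> is. So, with \<open>n = CARD('n)\<close>, there are at most
    \<open>C ^ n * Suc d ^ n\<close> monomials against \<open>Suc d * Suc d ^ n\<close> products,
    and \<open>d = C ^ n\<close> makes the former number smaller.\<close>
  define C where "C = CARD('n) * D + D + 1"
  define d where "d = C ^ CARD('n)"
  define N where "N = d * D + CARD('n) * (d * D)"
  define F where "F = (\<lambda>(k, \<beta>) c. evaluate c f ^ k * (\<Prod>i\<in>UNIV. evaluate c (y i) ^ \<beta> i))"
  have pw: "polyfun (d * D) (\<lambda>c. g c ^ k)" if "polyfun D g" "k \<le> d" for g :: "('n \<Rightarrow> 'k) \<Rightarrow> 'k" and k
    by (rule polyfun_mono[OF polyfun_power[OF that(1)]]) (simp add: that(2))
  have "polyfun N (F (k, \<beta>))" if "k \<le> d" "\<beta> \<in> box d" for k \<beta>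
    unfolding F_def prod.case N_def using that
    by (intro polyfun_mult polyfun_prod pw D) (auto simp: box_def)
  then have "\<forall>x\<in>{..d} \<times> box d. \<exists>B. \<forall>c. F x c = (\<Sum>\<beta>\<in>box N. B \<beta> * (\<Prod>i\<in>UNIV. c i ^ \<beta> i))"
    using polyfun_monomials by blast
  then obtain B where B: "\<And>x c. x \<in> {..d} \<times> box d \<Longrightarrow> F x c = (\<Sum>\<beta>\<in>box N. B x \<beta> * (\<Prod>i\<in>UNIV. c i ^ \<beta> i))"
    by metis
  have "card (box N :: ('n \<Rightarrow> nat) set) < card ({..d} \<times> (box d :: ('n \<Rightarrow> nat) set))"
  proof -
    have "Suc N \<le> C * Suc d" by (simp add: N_def C_def algebra_simps)
    then have "Suc N ^ CARD('n) \<le> C ^ CARD('n) * Suc d ^ CARD('n)"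
      by (metis power_mono power_mult_distrib le0)
    also have "\<dots> < Suc d * Suc d ^ CARD('n)"
      by (simp add: d_def)
    finally show ?thesis by (simp add: card_box card_cartesian_product)
  qed
  from homogeneous_system_nontrivial[OF finite_box _ this, of B] obtain a where
    a: "\<exists>x\<in>{..d} \<times> box d. a x \<noteq> 0" "\<And>\<beta>. \<beta> \<in> box N \<Longrightarrow> (\<Sum>x\<in>{..d} \<times> box d. a x * B x \<beta>) = 0"
    by (auto simp: finite_box)
  have "(\<Sum>(k, \<beta>)\<in>{..d} \<times> box d. a (k, \<beta>) * (evaluate c f ^ k * (\<Prod>i\<in>UNIV. evaluate c (y i) ^ \<beta> i))) = 0" for c
  proof -
    have "(\<Sum>(k, \<beta>)\<in>{..d} \<times> box d. a (k, \<beta>) * (evaluate c f ^ k * (\<Prod>i\<in>UNIV. evaluate c (y i) ^ \<beta> i)))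
        = (\<Sum>x\<in>{..d} \<times> box d. a x * F x c)"
      by (simp add: F_def case_prod_unfold)
    also have "\<dots> = (\<Sum>x\<in>{..d} \<times> box d. \<Sum>\<beta>\<in>box N. a x * B x \<beta> * (\<Prod>i\<in>UNIV. c i ^ \<beta> i))"
      by (intro sum.cong refl) (simp add: B sum_distrib_left mult.assoc)
    also have "\<dots> = (\<Sum>\<beta>\<in>box N. (\<Sum>x\<in>{..d} \<times> box d. a x * B x \<beta>) * (\<Prod>i\<in>UNIV. c i ^ \<beta> i))"
      by (subst sum.swap) (simp add: sum_distrib_right)
    also have "\<dots> = 0" using a(2) by simp
    finally show ?thesis .
  qed
  with a(1) show ?thesis by blast
qed

section \<open>The filtration by order\<close>

text \<open>The \<open>N\<close>-th power of the ideal generated by the variables. These powers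
  intersect in zero, which takes the place of working with power series.\<close>

definition order_ge :: "nat \<Rightarrow> ('n, 'k::field) free_algebra \<Rightarrow> bool" where
  "order_ge N p \<longleftrightarrow> (\<forall>w. length (letters w) < N \<longrightarrow> Poly_Mapping.lookup p w = 0)"

lemma order_ge_0 [simp]: "order_ge 0 p"
  by (simp add: order_ge_def)

lemma order_ge_zero [simp]: "order_ge N 0"
  by (simp add: order_ge_def)

lemma order_ge_add: "order_ge N p \<Longrightarrow> order_ge N q \<Longrightarrow> order_ge N (p + q)"
  by (simp add: order_ge_def lookup_add)

lemma order_ge_diff: "order_ge N p \<Longrightarrow> order_ge N q \<Longrightarrow> order_ge N (p - q)"
  by (simp add: order_ge_def lookup_minus)

lemma order_ge_sum: "(\<And>x. x \<in> A \<Longrightarrow> order_ge N (f x)) \<Longrightarrow> order_ge N (sum f A)"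
  by (simp add: order_ge_def lookup_sum)

lemma order_ge_const_mult: "order_ge N p \<Longrightarrow> order_ge N (const c * p)"
  by (simp add: order_ge_def)

lemma order_ge_mono: "order_ge N p \<Longrightarrow> M \<le> N \<Longrightarrow> order_ge M p"
  by (simp add: order_ge_def)

lemma order_ge_mult:
  assumes "order_ge N p" "order_ge M q"
  shows "order_ge (N + M) (p * q)"
  unfolding order_ge_def
proof (intro allI impI)
  fix w :: "'a free_monoid" assume w: "length (letters w) < N + M"
  show "Poly_Mapping.lookup (p * q) w = 0"
  proof (rule ccontr)
    assume "\<not> ?thesis"
    then have "w \<in> Poly_Mapping.keys (p * q)" by (simp add: in_keys_iff)
    then obtain u v where uv: "w = u + v" "u \<in> Poly_Mapping.keys p" "v \<in> Poly_Mapping.keys q"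
      using keys_mult[of p q] by auto
    then have "\<not> length (letters u) < N" "\<not> length (letters v) < M"
      using assms by (auto simp: order_ge_def in_keys_iff)
    then show False using w uv(1) by (simp add: plus_free_monoid_def)
  qed
qed

lemma order_ge_prod_list:
  "(\<And>i. order_ge 1 (g i)) \<Longrightarrow> order_ge (length xs) (prod_list (map g xs))"
proof (induction xs)
  case (Cons x xs)
  then show ?case using order_ge_mult[of 1 "g x" "length xs"] by simp
qed simp

lemma order_ge_var: "order_ge 1 (var i)"
  by (auto simp: order_ge_def var_def lookup_single when_def)

lemma order_ge_all_imp_0:
  assumes "\<And>N. order_ge N p"
  shows "p = 0"
proof (rule poly_mapping_eqI)
  fix w
  from assms[of "Suc (length (letters w))"]
  have "Poly_Mapping.lookup p w = 0" unfolding order_ge_def by blast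
  then show "Poly_Mapping.lookup p w = Poly_Mapping.lookup 0 w" by simp
qed

lemma obtain_order:
  assumes "p \<noteq> 0"
  obtains N where "order_ge N p" "\<not> order_ge (Suc N) p"
proof -
  have "\<exists>N. \<not> order_ge N p" using assms order_ge_all_imp_0 by blast
  then have "\<exists>N. order_ge N p \<and> \<not> order_ge (Suc N) p"
    using nat_induct[of "\<lambda>N. order_ge N p"] order_ge_0 by blast
  then show ?thesis using that by blast
qed

lemma free_algebra_expand:
  "p = (\<Sum>w\<in>Poly_Mapping.keys p. const (Poly_Mapping.lookup p w) * prod_list (map var (letters w)))"
proof -
  have *: "const c * prod_list (map var (letters w)) = Poly_Mapping.single w c" for w and c :: 'b
    using single_Word[of "letters w" c] by simp
  show ?thesis unfolding * by (rule sum_single_keys)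
qed

lemma algebra_hom_expand:
  assumes "algebra_hom const \<psi>"
  shows "\<psi> p = (\<Sum>w\<in>Poly_Mapping.keys p. const (Poly_Mapping.lookup p w) *
      prod_list (map (\<lambda>i. \<psi> (var i)) (letters w)))"
  by (rule algebra_hom_eq_free_lift[OF assms central_embedding_const, unfolded free_lift_def])

lemma order_ge_hom:
  assumes "algebra_hom const \<psi>" "\<And>i. order_ge 1 (\<psi> (var i))" "order_ge N p"
  shows "order_ge N (\<psi> p)"
  unfolding algebra_hom_expand[OF assms(1), of p]
proof (intro order_ge_sum order_ge_const_mult)
  fix w assume "w \<in> Poly_Mapping.keys p"
  then have "N \<le> length (letters w)"
    using assms(3) by (auto simp: order_ge_def in_keys_iff not_less[symmetric])
  then show "order_ge N (prod_list (map (\<lambda>i. \<psi> (var i)) (letters w)))"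
    using order_ge_prod_list[of "\<lambda>i. \<psi> (var i)", OF assms(2)] order_ge_mono by blast
qed

text \<open>Such an endomorphism induces the identity on the graded pieces of the filtration:
  replacing one letter of a word at a time, every replacement raises the order by one.\<close>

lemma order_ge_hom_diff:
  assumes "algebra_hom const \<psi>" "\<And>i. order_ge 2 (\<psi> (var i) - var i)" "order_ge N p"
  shows "order_ge (Suc N) (\<psi> p - p)"
proof -
  have 1: "order_ge 1 (\<psi> (var i))" for i
    using order_ge_add[OF order_ge_mono[OF assms(2)[of i], of 1] order_ge_var[of i]] by simp
  have *: "order_ge (Suc (length xs)) (prod_list (map (\<lambda>i. \<psi> (var i)) xs) - prod_list (map var xs))" for xs
  proof (induction xs)
    case (Cons x xs)
    let ?P = "prod_list (map (\<lambda>i. \<psi> (var i)) xs)" and ?Q = "prod_list (map var xs)"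
    have "\<psi> (var x) * ?P - var x * ?Q = (\<psi> (var x) - var x) * ?P + var x * (?P - ?Q)"
      by (simp add: algebra_simps)
    moreover have "order_ge (2 + length xs) ((\<psi> (var x) - var x) * ?P)"
      using assms(2) 1 by (intro order_ge_mult order_ge_prod_list)
    moreover have "order_ge (1 + Suc (length xs)) (var x * (?P - ?Q))"
      using Cons.IH order_ge_var by (intro order_ge_mult)
    ultimately show ?case by (simp add: order_ge_add)
  qed simp
  have "\<psi> p - p = (\<Sum>w\<in>Poly_Mapping.keys p. const (Poly_Mapping.lookup p w) *
      (prod_list (map (\<lambda>i. \<psi> (var i)) (letters w)) - prod_list (map var (letters w))))"
    using arg_cong2[OF algebra_hom_expand[OF assms(1), of p] free_algebra_expand[of p], of "(-)"]
    by (simp only: sum_subtractf right_diff_distrib)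
  also have "order_ge (Suc N) \<dots>"
  proof (intro order_ge_sum order_ge_const_mult)
    fix w assume "w \<in> Poly_Mapping.keys p"
    then have "N \<le> length (letters w)"
      using assms(3) by (auto simp: order_ge_def in_keys_iff not_less[symmetric])
    then show "order_ge (Suc N) (prod_list (map (\<lambda>i. \<psi> (var i)) (letters w)) - prod_list (map var (letters w)))"
      using * by (intro order_ge_mono[OF *]) simp
  qed
  finally show ?thesis .
qed

lemma evaluate_zero:
  fixes p :: "('a, 'b::field) free_algebra"
  shows "evaluate (\<lambda>_. 0) p = Poly_Mapping.lookup p (Word [])"
proof -
  have "prod_list (map (\<lambda>_. 0 :: 'b) (letters w)) = (if w = Word [] then 1 else 0)" for w :: "'a free_monoid"
    by (cases w; cases "letters w") auto
  then have "evaluate (\<lambda>_. 0) p = (\<Sum>w\<in>Poly_Mapping.keys p. if w = Word [] then Poly_Mapping.lookup p w else 0)"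
    unfolding evaluate_def free_lift_def by (intro sum.cong) auto
  then show ?thesis by (simp add: in_keys_iff)
qed

lemma letters_eq_iff: "letters w = xs \<longleftrightarrow> w = Word xs"
  by (cases w) simp

text \<open>On the \<open>j\<close>-th coordinate axis only words in the letter \<open>j\<close>
  survive, and each contributes the power given by its length.\<close>

lemma coeff_line_zero:
  fixes p :: "('a, 'b::field) free_algebra"
  shows "coeff (line (\<lambda>_. 0) (\<lambda>i. if i = j then 1 else 0) p) 1 = Poly_Mapping.lookup p (Word [j])"
proof -
  have "prod_list (map (\<lambda>i. [:0, if i = j then 1 else 0 :: 'b:]) xs) =
      (if set xs \<subseteq> {j} then monom 1 (length xs) else 0)" for xs
    by (induction xs) (auto simp: monom_Suc)
  moreover have "set xs \<subseteq> {j} \<and> length xs = 1 \<longleftrightarrow> xs = [j]" for xs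
    by (auto simp: length_Suc_conv)
  ultimately have "coeff (prod_list (map (\<lambda>i. [:0, if i = j then 1 else 0 :: 'b:]) xs)) 1 =
      (if xs = [j] then 1 else 0)" for xs
    by (auto simp: coeff_monom)
  then have "coeff (line (\<lambda>_. 0) (\<lambda>i. if i = j then 1 else 0) p) 1 =
      (\<Sum>w\<in>Poly_Mapping.keys p. if w = Word [j] then Poly_Mapping.lookup p w else 0)"
    unfolding line_def free_lift_def coeff_sum letters_eq_iff[symmetric]
    by (intro sum.cong) (auto simp: coeff_pCons split: nat.splits free_monoid.splits)
  then show ?thesis by (simp add: in_keys_iff)
qed

text \<open>Values at the origin and on the coordinate axes determine the constant and linear
  coefficients. Order 2 is all one can hope for, since commutators vanish at every point, and it is
  what \<open>trivial_to_first_order\<close> asks for.\<close>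

lemma evaluate_zero_imp_order_ge_2:
  fixes p :: "('n, 'k::field) free_algebra"
  assumes "infinite (UNIV :: 'k set)" "\<And>c. evaluate c p = 0"
  shows "order_ge 2 p"
  unfolding order_ge_def
proof (intro allI impI)
  fix w :: "'n free_monoid" assume w: "length (letters w) < 2"
  show "Poly_Mapping.lookup p w = 0"
  proof (cases "letters w")
    case Nil
    then have "w = Word []" by (cases w) auto
    then show ?thesis using assms(2) evaluate_zero[of p] by simp
  next
    case (Cons j xs)
    then have w: "w = Word [j]" using w by (cases w) auto
    have "line (\<lambda>_. 0) (\<lambda>i. if i = j then 1 else 0) p = 0"
      by (rule poly_eqI_infinite[OF assms(1)]) (simp add: poly_line assms(2))
    then show ?thesis using coeff_line_zero[of j p] w by simp
  qed
qed

section \<open>Weight vectors\<close>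

lemma chr_independent_family:
  fixes X :: "'x \<Rightarrow> 'k::field" and w :: "'x \<Rightarrow> 'n::finite \<Rightarrow> int"
  assumes "infinite (UNIV :: 'k set)" "finite B" "inj_on w B"
    and "\<And>t. t \<in> torus \<Longrightarrow> (\<Sum>x\<in>B. X x * chr t (w x)) = 0" and "x \<in> B"
  shows "X x = 0"
proof -
  have "(\<Sum>a\<in>w ` B. X (the_inv_into B w a) * chr t a) = 0" if "t \<in> torus" for t
    using assms(4)[OF that] assms(3)
    by (simp add: sum.reindex the_inv_into_f_f cong: sum.cong_simp)
  from chr_independent[OF assms(1) _ this, of "w x"] assms show ?thesis
    by (simp add: the_inv_into_f_f)
qed

text \<open>The vector \<open>l\<close> defines the one-parameter subgroup
  \<open>z \<mapsto> (z ^ l j)\<close>, on which all characters in \<open>S\<close> are trivial. A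
  nonzero \<open>l j\<close> and a scalar with \<open>z powi l j \<noteq> 1\<close> would give a
  nontrivial common kernel.\<close>

lemma orthogonal_to_faithful_characters:
  fixes S :: "('n::finite \<Rightarrow> int) set"
  assumes "infinite (UNIV :: 'k::field set)"
    and "\<And>t::'n \<Rightarrow> 'k. t \<in> torus \<Longrightarrow> \<forall>a\<in>S. chr t a = 1 \<Longrightarrow> t = (\<lambda>_. 1)"
    and "\<forall>a\<in>S. (\<Sum>j\<in>UNIV. l j * a j) = 0"
  shows "\<forall>j. l j = 0"
proof (rule ccontr)
  assume "\<not> ?thesis"
  then obtain j where "l j \<noteq> 0" by blast
  then obtain z :: 'k where z: "z \<noteq> 0" "z powi l j \<noteq> 1" using powi_ne_1[OF assms(1)] by blast
  define t where "t = (\<lambda>i. z powi l i)"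
  have "z powi (\<Sum>i\<in>I. m i) = (\<Prod>i\<in>I. z powi m i)" if "finite I" for I :: "'n set" and m
    using that z(1) by (induction I rule: finite_induct) (simp_all add: power_int_add)
  then have "chr t a = z powi (\<Sum>i\<in>UNIV. l i * a i)" for a
    by (simp add: chr_def t_def power_int_mult[symmetric])
  then have "\<forall>a\<in>S. chr t a = 1" using assms(3) by simp
  moreover have "t \<in> torus" using z(1) by (simp add: torus_def t_def)
  ultimately have "t = (\<lambda>_. 1)" using assms(2) by blast
  then have "t j = 1" by simp
  then show False using z(2) by (simp add: t_def)
qed

definition weight ::
    "(('n::finite \<Rightarrow> 'k::field) \<Rightarrow> ('n, 'k) free_algebra \<Rightarrow> ('n, 'k) free_algebra) \<Rightarrow>
     ('n \<Rightarrow> int) \<Rightarrow> ('n, 'k) free_algebra \<Rightarrow> bool" where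
  "weight \<sigma> a p \<longleftrightarrow> (\<forall>t\<in>torus. \<sigma> t p = const (chr t a) * p)"

text \<open>Algebraicity and the group law enter through the decomposition into weight vectors. In
  this form the assumptions pass easily to conjugate actions, to which the results are applied after
  moving the fixed point and after the linear change of coordinates.\<close>

locale torus_action =
  fixes \<sigma> :: "('n::finite \<Rightarrow> 'k::field) \<Rightarrow> ('n, 'k) free_algebra \<Rightarrow> ('n, 'k) free_algebra"
  assumes infinite_field: "infinite (UNIV :: 'k set)"
    and aut: "t \<in> torus \<Longrightarrow> algebra_automorphism (\<sigma> t)"
    and weights_span: "\<exists>A f. finite A \<and> (\<forall>a\<in>A. weight \<sigma> a (f a)) \<and> p = sum f A"
    and faithful: "t \<in> torus \<Longrightarrow> \<sigma> t = id \<Longrightarrow> t = (\<lambda>_. 1)"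
begin

lemma hom: "t \<in> torus \<Longrightarrow> algebra_hom const (\<sigma> t)"
  using aut by (simp add: algebra_automorphism_iff)

lemma weight_mult:
  assumes "weight \<sigma> a p" "weight \<sigma> b q"
  shows "weight \<sigma> (\<lambda>i. a i + b i) (p * q)"
  unfolding weight_def
proof
  fix t :: "'n \<Rightarrow> 'k" assume t: "t \<in> torus"
  have "\<sigma> t (p * q) = (const (chr t a) * p) * (const (chr t b) * q)"
    using assms t by (simp add: weight_def algebra_homD[OF hom[OF t]])
  also have "\<dots> = const (chr t a) * (p * const (chr t b)) * q" by (simp only: mult.assoc)
  also have "\<dots> = const (chr t a) * (const (chr t b) * p) * q" by (simp only: const_commute)
  also have "\<dots> = const (chr t (\<lambda>i. a i + b i)) * (p * q)"
    by (simp only: chr_add[OF t] const_mult mult.assoc)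
  finally show "\<sigma> t (p * q) = const (chr t (\<lambda>i. a i + b i)) * (p * q)" .
qed

lemma weight_const: "weight \<sigma> (\<lambda>i. 0) (const c)"
  by (simp add: weight_def algebra_homD[OF hom])

lemma weight_add: "weight \<sigma> a p \<Longrightarrow> weight \<sigma> a q \<Longrightarrow> weight \<sigma> a (p + q)"
  by (simp add: weight_def algebra_homD[OF hom] distrib_left)

lemma weight_diff: "weight \<sigma> a p \<Longrightarrow> weight \<sigma> a q \<Longrightarrow> weight \<sigma> a (p - q)"
  by (simp add: weight_def algebra_homD[OF hom] right_diff_distrib)

lemma weight_zero: "weight \<sigma> a 0"
  by (simp add: weight_def algebra_homD[OF hom])

lemma weight_const_mult: "weight \<sigma> a p \<Longrightarrow> weight \<sigma> a (const c * p)"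
  using weight_mult[OF weight_const] by fastforce

lemma weight_prod_list:
  assumes "\<And>i. weight \<sigma> (\<omega> i) (y i)"
  shows "weight \<sigma> (\<lambda>j. \<Sum>i\<leftarrow>xs. \<omega> i j) (prod_list (map y xs))"
proof (induction xs)
  case Nil
  then show ?case using weight_const[of 1] by simp
next
  case (Cons x xs)
  then show ?case using weight_mult[OF assms] by simp
qed

lemma act_sum:
  assumes "\<And>a. a \<in> A \<Longrightarrow> weight \<sigma> a (f a)" "t \<in> torus"
  shows "\<sigma> t (sum f A) = (\<Sum>a\<in>A. const (chr t a) * f a)"
  using assms by (simp add: algebra_hom_sum[OF hom] weight_def cong: sum.cong_simp)

text \<open>The coefficient of a short word in \<open>\<sigma> t (sum f A)\<close> is a combination
  of distinct characters of \<open>t\<close>, so its vanishing for all \<open>t\<close> kills every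
  term. The assumption ranges over all \<open>t\<close> because the action need not preserve order
  unless it fixes the origin.\<close>

lemma weight_components_order_ge:
  assumes "finite A" "\<And>a. a \<in> A \<Longrightarrow> weight \<sigma> a (f a)"
    and "\<And>t. t \<in> torus \<Longrightarrow> order_ge N (\<sigma> t (sum f A))" and "a \<in> A"
  shows "order_ge N (f a)"
  unfolding order_ge_def
proof (intro allI impI)
  fix w :: "'n free_monoid" assume w: "length (letters w) < N"
  have "(\<Sum>a\<in>A. Poly_Mapping.lookup (f a) w * chr t a) = 0" if "t \<in> torus" for t
    using assms(3)[OF that] w
    by (simp add: act_sum[OF assms(2) that] order_ge_def lookup_sum mult.commute)
  from chr_independent[OF infinite_field assms(1) this assms(4)]
  show "Poly_Mapping.lookup (f a) w = 0" .
qed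

lemma weight_components_zero:
  assumes "finite A" "\<And>a. a \<in> A \<Longrightarrow> weight \<sigma> a (f a)" "sum f A = 0" "a \<in> A"
  shows "f a = 0"
proof (rule order_ge_all_imp_0)
  fix N
  show "order_ge N (f a)"
    by (rule weight_components_order_ge[OF assms(1,2) _ assms(4)]) (simp_all add: assms(3) algebra_homD[OF hom])
qed

text \<open>
  An element acting trivially to first order is unipotent with respect to the filtration, and it is
  diagonalizable.
\<close>

lemma trivial_to_first_order:
  assumes t: "t \<in> torus" and "\<And>i. order_ge 2 (\<sigma> t (var i) - var i)"
  shows "t = (\<lambda>_. 1)"
proof (rule faithful[OF t])
  have *: "\<sigma> t p = p" if "weight \<sigma> a p" for a p
  proof (cases "p = 0")
    case True
    then show ?thesis by (simp add: algebra_homD[OF hom[OF t]])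
  next
    case False
    then obtain N where N: "order_ge N p" "\<not> order_ge (Suc N) p" by (rule obtain_order)
    have "order_ge (Suc N) (\<sigma> t p - p)"
      by (rule order_ge_hom_diff[OF hom[OF t] assms(2) N(1)])
    moreover have eq: "\<sigma> t p - p = const (chr t a - 1) * p"
      using that t by (simp add: weight_def const_diff left_diff_distrib)
    \<comment> \<open>A nonzero scalar multiple of \<open>p\<close> has the same order as
      \<open>p\<close>, which is exactly \<open>N\<close>.\<close>
    ultimately have "chr t a - 1 = 0"
      using N(2) by (auto simp: order_ge_def)
    then show ?thesis using eq by simp
  qed
  show "\<sigma> t = id"
  proof
    fix p
    obtain A f where "finite A" "\<forall>a\<in>A. weight \<sigma> a (f a)" "p = sum f A"
      using weights_span[of p] by blast
    then have "\<sigma> t p = (\<Sum>a\<in>A. \<sigma> t (f a))" by (simp add: algebra_hom_sum[OF hom[OF t]])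
    also have "\<dots> = sum f A"
      by (rule sum.cong[OF refl], rule *) (use \<open>\<forall>a\<in>A. weight \<sigma> a (f a)\<close> in blast)
    finally show "\<sigma> t p = id p" using \<open>p = sum f A\<close> by simp
  qed
qed

section \<open>The fixed point\<close>

definition act :: "('n \<Rightarrow> 'k) \<Rightarrow> ('n \<Rightarrow> 'k) \<Rightarrow> ('n \<Rightarrow> 'k)" where
  "act t c = (\<lambda>i. evaluate c (\<sigma> t (var i)))"

lemma evaluate_act:
  assumes "t \<in> torus"
  shows "evaluate (act t c) p = evaluate c (\<sigma> t p)"
proof -
  have "algebra_hom (\<lambda>a. a) (evaluate c \<circ> \<sigma> t)"
    by (rule algebra_hom_comp[OF algebra_hom_evaluate hom[OF assms]])
  from fun_cong[OF algebra_hom_eq_evaluate[OF this], of p] show ?thesis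
    by (simp only: act_def o_apply)
qed

lemma evaluate_act_weight:
  "t \<in> torus \<Longrightarrow> weight \<sigma> a p \<Longrightarrow> evaluate (act t c) p = chr t a * evaluate c p"
  by (simp add: evaluate_act weight_def)

text \<open>If all weights of nonzero functions are trivial at \<open>t\<close>, then
  \<open>\<sigma> t\<close> fixes every function. So \<open>\<sigma> t (var i) - var i\<close>
  vanishes at all points, has order at least 2, and \<open>t\<close> is the identity.\<close>

lemma independent_weights_of_functions:
  "\<exists>\<omega> y. int_independent \<omega> \<and> (\<forall>i. weight \<sigma> (\<omega> i) (y i) \<and> (\<exists>c. evaluate c (y i) \<noteq> 0))"
proof -
  define S where "S = {a. \<exists>p c. weight \<sigma> a p \<and> evaluate c p \<noteq> 0}"
  have "t = (\<lambda>_. 1)" if t: "t \<in> torus" "\<forall>a\<in>S. chr t a = 1" for t :: "'n \<Rightarrow> 'k"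
  proof (rule trivial_to_first_order[OF t(1)])
    fix i
    have "evaluate c (\<sigma> t p) = evaluate c p" for c p
    proof -
      obtain A f where A: "finite A" "\<And>a. a \<in> A \<Longrightarrow> weight \<sigma> a (f a)" "p = sum f A"
        using weights_span[of p] by blast
      have *: "chr t a * evaluate c (f a) = evaluate c (f a)" if "a \<in> A" for a
        using t(2) A(2)[OF that] by (cases "evaluate c (f a) = 0") (auto simp: S_def)
      then show ?thesis
        by (simp add: A(3) act_sum[OF A(2) t(1)] evaluate_sum * del: mult_cancel_right1 cong: sum.cong_simp)
    qed
    then show "order_ge 2 (\<sigma> t (var i) - var i)"
      by (intro evaluate_zero_imp_order_ge_2[OF infinite_field]) (simp del: evaluate_var)
  qed
  then have "\<exists>\<omega>. range \<omega> \<subseteq> S \<and> int_independent \<omega>"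
    using orthogonal_to_faithful_characters[OF infinite_field] by (intro int_independent_subset) blast
  then obtain \<omega> where \<omega>: "int_independent \<omega>" "\<And>i. \<exists>p c. weight \<sigma> (\<omega> i) p \<and> evaluate c p \<noteq> 0"
    unfolding S_def by blast
  then show ?thesis by metis
qed

end

lemma evaluate_prod_nonzero:
  fixes y :: "'i \<Rightarrow> ('n, 'k::field) free_algebra"
  assumes "infinite (UNIV :: 'k set)" "finite I" "\<And>i. i \<in> I \<Longrightarrow> \<exists>c. evaluate c (y i) \<noteq> 0"
  shows "\<exists>p. (\<forall>c. evaluate c p = (\<Prod>i\<in>I. evaluate c (y i) ^ \<beta> i)) \<and> (\<exists>c. evaluate c p \<noteq> 0)"
  using assms(2,3)
proof (induction I rule: finite_induct)
  case empty
  then show ?case by (intro exI[of _ 1]) simp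
next
  case (insert i I)
  then have "\<exists>p. (\<forall>c. evaluate c p = (\<Prod>i\<in>I. evaluate c (y i) ^ \<beta> i)) \<and> (\<exists>c. evaluate c p \<noteq> 0)" by blast
  then obtain p where p: "\<And>c. evaluate c p = (\<Prod>i\<in>I. evaluate c (y i) ^ \<beta> i)" "\<exists>c. evaluate c p \<noteq> 0" by blast
  have pw: "evaluate c (y i ^ k) = evaluate c (y i) ^ k" for c k by (induction k) simp_all
  from insert.prems obtain c where "evaluate c (y i) \<noteq> 0" by blast
  then have "evaluate c (y i ^ \<beta> i) \<noteq> 0" by (simp add: pw)
  with p(2) evaluate_prod_zero[OF assms(1), of "y i ^ \<beta> i" p] have "\<exists>c. evaluate c (y i ^ \<beta> i * p) \<noteq> 0"
    by auto
  moreover have "evaluate c (y i ^ \<beta> i * p) = (\<Prod>i\<in>insert i I. evaluate c (y i) ^ \<beta> i)" for c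
    using insert(1,2) by (simp add: pw p(1))
  ultimately show ?case by blast
qed

context torus_action
begin

text \<open>
  Together with functions of independent weights, a nonconstant invariant function would form
  \<open>n + 1\<close> algebraically independent functions in \<open>n\<close> variables.
\<close>

lemma invariant_constant:
  assumes "weight \<sigma> (\<lambda>_. 0) f"
  shows "evaluate c f = evaluate d f"
proof -
  obtain \<omega> y where \<omega>: "int_independent \<omega>" and y: "\<And>i. weight \<sigma> (\<omega> i) (y i)" "\<And>i. \<exists>c. evaluate c (y i) \<noteq> 0"
    using independent_weights_of_functions by blast
  obtain D a where a: "\<exists>x\<in>{..D} \<times> box D. a x \<noteq> 0"
    "\<And>c. (\<Sum>(k, \<beta>)\<in>{..D} \<times> box D. a (k, \<beta>) * (evaluate c f ^ k * (\<Prod>i\<in>UNIV. evaluate c (y i) ^ \<beta> i))) = 0"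
    using algebraically_dependent[of f y] by blast
  from a(1) obtain k0 \<beta> where \<beta>: "\<beta> \<in> box D" "k0 \<le> D" "a (k0, \<beta>) \<noteq> 0" by auto
  define w where "w \<beta> = (\<lambda>j. \<Sum>i\<in>UNIV. int (\<beta> i) * \<omega> i j)" for \<beta> :: "'n \<Rightarrow> nat"
  define G where "G \<beta> c = (\<Sum>k\<le>D. a (k, \<beta>) * evaluate c f ^ k)" for \<beta> c
  define M where "M \<beta> c = (\<Prod>i\<in>UNIV. evaluate c (y i) ^ \<beta> i)" for \<beta> c
  have inj: "inj_on w (box D)"
  proof (rule inj_onI, rule ext)
    fix \<beta> \<beta>' i assume "w \<beta> = w \<beta>'"
    then have "\<forall>j. (\<Sum>i\<in>UNIV. (int (\<beta> i) - int (\<beta>' i)) * \<omega> i j) = 0"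
      by (simp add: w_def fun_eq_iff left_diff_distrib sum_subtractf)
    then have "\<forall>i. int (\<beta> i) - int (\<beta>' i) = 0"
      using \<omega>[unfolded int_independent_def, THEN spec, of "\<lambda>i. int (\<beta> i) - int (\<beta>' i)"] by simp
    then show "\<beta> i = \<beta>' i" by simp
  qed
  have M_act: "M \<beta> (act t c) = chr t (w \<beta>) * M \<beta> c" if "t \<in> torus" for \<beta> t c
    unfolding M_def w_def chr_sum[OF that] using that
    by (simp add: evaluate_act_weight[OF that y(1)] chr_powi power_mult_distrib prod.distrib)
  have G_act: "G \<beta> (act t c) = G \<beta> c" if "t \<in> torus" for \<beta> t c
    by (simp add: G_def evaluate_act_weight[OF that assms])
  \<comment> \<open>Along the orbit of \<open>c\<close> the monomial of exponent
    \<open>\<beta>\<close> is multiplied by the character \<open>w \<beta>\<close>, while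
    \<open>f\<close> does not change. As these characters are distinct, the dependence relation
    splits into one relation for each \<open>\<beta>\<close>.\<close>
  have GM: "G \<beta> c * M \<beta> c = 0" for c
  proof (rule chr_independent_family[OF infinite_field finite_box inj _ \<beta>(1)])
    fix t :: "'n \<Rightarrow> 'k" assume t: "t \<in> torus"
    have "0 = (\<Sum>(k, \<beta>)\<in>{..D} \<times> box D. a (k, \<beta>) * (evaluate (act t c) f ^ k * M \<beta> (act t c)))"
      by (simp add: M_def a(2))
    also have "\<dots> = (\<Sum>\<beta>\<in>box D. \<Sum>k\<le>D. a (k, \<beta>) * (evaluate (act t c) f ^ k * M \<beta> (act t c)))"
      by (subst sum.swap) (simp add: sum.cartesian_product)
    also have "\<dots> = (\<Sum>\<beta>\<in>box D. G \<beta> (act t c) * M \<beta> (act t c))"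
      by (simp add: G_def sum_distrib_right mult.assoc)
    also have "\<dots> = (\<Sum>\<beta>\<in>box D. (G \<beta> c * M \<beta> c) * chr t (w \<beta>))"
      by (simp add: M_act[OF t] G_act[OF t] mult_ac)
    finally show "(\<Sum>\<beta>\<in>box D. (G \<beta> c * M \<beta> c) * chr t (w \<beta>)) = 0" by simp
  qed
  define g where "g = (\<Sum>k\<le>D. const (a (k, \<beta>)) * f ^ k)"
  have "evaluate c (f ^ k) = evaluate c f ^ k" for c k by (induction k) simp_all
  then have g: "evaluate c g = G \<beta> c" for c
    by (simp add: g_def G_def evaluate_sum)
  have "\<exists>p. (\<forall>c. evaluate c p = M \<beta> c) \<and> (\<exists>c. evaluate c p \<noteq> 0)"
    unfolding M_def by (rule evaluate_prod_nonzero[OF infinite_field finite_class.finite_UNIV y(2)])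
  then obtain p where p: "\<And>c. evaluate c p = M \<beta> c" "\<exists>c. evaluate c p \<noteq> 0"
    by blast
  \<comment> \<open>The monomial is a nonzero function, so the other factor of the zero product
    vanishes identically.\<close>
  have G0: "G \<beta> c = 0" for c
    using evaluate_prod_zero[OF infinite_field, of g p] GM p g by auto
  \<comment> \<open>All values of \<open>f\<close> are roots of this nonzero univariate polynomial,
    so \<open>f\<close> has finitely many values.\<close>
  define P where "P = (\<Sum>k\<le>D. monom (a (k, \<beta>)) k)"
  have "coeff P k0 = a (k0, \<beta>)"
    using \<beta>(2) by (simp add: P_def coeff_sum)
  then have "P \<noteq> 0" using \<beta>(3) by auto
  then have "finite {x. poly P x = 0}" by (rule poly_roots_finite)
  moreover have "evaluate c f \<in> {x. poly P x = 0}" for c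
    using G0[of c] by (simp add: P_def G_def poly_sum poly_monom)
  ultimately show ?thesis
    by (rule evaluate_finite_range_constant[OF infinite_field])
qed

text \<open>The projection to a weight space. A total function with finite support allows two
  decompositions to be compared weight by weight; \<open>component_eqI\<close> shows that the result
  does not depend on the choice.\<close>

definition component :: "('n, 'k) free_algebra \<Rightarrow> ('n \<Rightarrow> int) \<Rightarrow> ('n, 'k) free_algebra" where
  "component p = (SOME f. finite {a. f a \<noteq> 0} \<and> (\<forall>a. weight \<sigma> a (f a)) \<and> p = sum f {a. f a \<noteq> 0})"

lemma component:
  shows finite_component: "finite {a. component p a \<noteq> 0}"
    and weight_component: "weight \<sigma> a (component p a)"
    and sum_component: "p = sum (component p) {a. component p a \<noteq> 0}"
proof -
  obtain A f where A: "finite A" "\<forall>a\<in>A. weight \<sigma> a (f a)" "p = sum f A"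
    using weights_span[of p] by blast
  define g where "g a = (if a \<in> A then f a else 0)" for a
  have sub: "{a. g a \<noteq> 0} \<subseteq> A" by (auto simp: g_def)
  have "sum g {a. g a \<noteq> 0} = sum g A"
    by (rule sum.mono_neutral_left[OF A(1) sub]) auto
  also have "\<dots> = p" using A(3) by (simp add: g_def)
  finally have "finite {a. g a \<noteq> 0} \<and> (\<forall>a. weight \<sigma> a (g a)) \<and> p = sum g {a. g a \<noteq> 0}"
    using A(1,2) sub by (auto simp: g_def weight_zero finite_subset)
  from someI[of "\<lambda>f. finite {a. f a \<noteq> 0} \<and> (\<forall>a. weight \<sigma> a (f a)) \<and> p = sum f {a. f a \<noteq> 0}", OF this]
  have *: "finite {a. component p a \<noteq> 0} \<and> (\<forall>a. weight \<sigma> a (component p a)) \<and>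
      p = sum (component p) {a. component p a \<noteq> 0}"
    unfolding component_def .
  show "finite {a. component p a \<noteq> 0}" "weight \<sigma> a (component p a)"
    using * by blast+
  show "p = sum (component p) {a. component p a \<noteq> 0}"
    using * by blast
qed

text \<open>The difference of two decompositions, taken over the union of their supports, is a sum
  of weight vectors equal to zero, and weight spaces are independent.\<close>

lemma component_eqI:
  assumes "finite A" "\<And>a. a \<in> A \<Longrightarrow> weight \<sigma> a (f a)" "p = sum f A"
  shows "component p a = (if a \<in> A then f a else 0)"
proof -
  let ?B = "{a. component p a \<noteq> 0}"
  define g where "g a = (if a \<in> A then f a else 0) - component p a" for a
  have "sum (\<lambda>a. if a \<in> A then f a else 0) (A \<union> ?B) = sum (\<lambda>a. if a \<in> A then f a else 0) A"
    by (rule sum.mono_neutral_right) (use assms(1) finite_component[of p] in auto)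
  then have 1: "sum (\<lambda>a. if a \<in> A then f a else 0) (A \<union> ?B) = p" using assms(3) by simp
  have "sum (component p) (A \<union> ?B) = sum (component p) ?B"
    by (rule sum.mono_neutral_right) (use assms(1) finite_component[of p] in auto)
  then have 2: "sum (component p) (A \<union> ?B) = p" using sum_component[of p] by simp
  have g0: "sum g (A \<union> ?B) = 0" unfolding g_def sum_subtractf 1 2 by simp
  have wg: "weight \<sigma> a (g a)" for a
    unfolding g_def by (intro weight_diff weight_component) (simp add: weight_zero assms(2))
  have "g a = 0" if "a \<in> A \<union> ?B"
    by (rule weight_components_zero[OF _ wg g0 that]) (use assms(1) finite_component[of p] in blast)
  then show ?thesis by (cases "a \<in> A \<union> ?B") (auto simp: g_def)
qed

lemma component_weight: "weight \<sigma> b p \<Longrightarrow> component p a = (if a = b then p else 0)"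
  using component_eqI[of "{b}" "\<lambda>_. p" p a] by simp

lemma component_add: "component (p + q) a = component p a + component q a"
proof -
  let ?A = "{a. component p a \<noteq> 0}" and ?B = "{a. component q a \<noteq> 0}"
  have "sum (component p) (?A \<union> ?B) = sum (component p) ?A"
    "sum (component q) (?A \<union> ?B) = sum (component q) ?B"
    by (rule sum.mono_neutral_right; use finite_component in auto)+
  then have "p + q = (\<Sum>a\<in>?A \<union> ?B. component p a + component q a)"
    using sum_component[of p] sum_component[of q] by (simp add: sum.distrib)
  from component_eqI[OF _ _ this, of a]
  have "component (p + q) a = (if a \<in> ?A \<union> ?B then component p a + component q a else 0)"
    using finite_component weight_add[OF weight_component weight_component] by blast
  then show ?thesis by auto
qed

lemma component_sum: "component (sum f A) a = (\<Sum>x\<in>A. component (f x) a)"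
proof (induction A rule: infinite_finite_induct)
  case (infinite A)
  then show ?case using component_weight[OF weight_zero, of a a] by simp
next
  case empty
  then show ?case using component_weight[OF weight_zero, of a a] by simp
qed (simp add: component_add)

text \<open>
  An invariant product of two weight functions is constant; if it is not zero, then the factors are
  units, hence constant, hence of weight zero.
\<close>

lemma invariant_product_zero:
  assumes "weight \<sigma> a p" "weight \<sigma> b q" "(\<lambda>i. a i + b i) = (\<lambda>_. 0)" "a \<noteq> (\<lambda>_. 0)"
  shows "evaluate c (p * q) = 0"
proof (rule ccontr)
  assume nz: "evaluate c (p * q) \<noteq> 0"
  have "weight \<sigma> (\<lambda>_. 0) (p * q)"
    using weight_mult[OF assms(1,2)] by (simp add: assms(3))
  then have const: "evaluate d p * evaluate d q = evaluate c (p * q)" for d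
    using invariant_constant[of "p * q" d c] by simp
  have "chr t a = 1" if "t \<in> torus" for t :: "'n \<Rightarrow> 'k"
  proof -
    have "evaluate (act t c) p = evaluate c p"
      by (rule evaluate_unit_constant[OF infinite_field const nz])
    moreover have "evaluate c p \<noteq> 0" using nz by auto
    ultimately show ?thesis by (simp add: evaluate_act_weight[OF that assms(1)])
  qed
  moreover obtain s :: "'n \<Rightarrow> 'k" where "s \<in> torus" "chr s a \<noteq> chr s (\<lambda>_. 0)"
    using chr_separates[OF infinite_field assms(4)] by blast
  ultimately show False by simp
qed

lemma fixed_point: "\<exists>e. \<forall>t\<in>torus. \<forall>p. evaluate e (\<sigma> t p) = evaluate e p"
proof -
  \<comment> \<open>The origin is an arbitrary base point: by \<open>invariant_constant\<close> the
    component of weight zero has the same value everywhere.\<close>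
  define \<epsilon> where "\<epsilon> p = evaluate (\<lambda>_. 0) (component p (\<lambda>_. 0))" for p
  have "\<epsilon> (p * q) = \<epsilon> p * \<epsilon> q" for p q
  proof -
    \<comment> \<open>Weight zero is inserted so that both sums contain the index that is singled
      out at the end, even if that component is zero.\<close>
    let ?A = "insert (\<lambda>_. 0) {a. component p a \<noteq> 0}" and ?B = "insert (\<lambda>_. 0) {a. component q a \<noteq> 0}"
    have fin: "finite ?A" "finite ?B" using finite_component by auto
    have p: "p = sum (component p) ?A"
      using sum_component[of p] finite_component[of p] by (auto simp: sum.insert_if)
    have q: "q = sum (component q) ?B"
      using sum_component[of q] finite_component[of q] by (auto simp: sum.insert_if)
    have "p * q = (\<Sum>a\<in>?A. \<Sum>b\<in>?B. component p a * component q b)"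
      using arg_cong2[OF p q, of "(*)"] by (simp only: sum_product)
    then have "\<epsilon> (p * q) = (\<Sum>a\<in>?A. \<Sum>b\<in>?B. evaluate (\<lambda>_. 0) (component (component p a * component q b) (\<lambda>_. 0)))"
      by (simp only: \<epsilon>_def component_sum evaluate_sum)
    \<comment> \<open>Only pairs of opposite weights contribute to weight zero, and by
      \<open>invariant_product_zero\<close> those with \<open>a\<close> nonzero evaluate to
      zero.\<close>
    also have "\<dots> = (\<Sum>a\<in>?A. \<Sum>b\<in>?B. if a = (\<lambda>_. 0) then if b = (\<lambda>_. 0) then \<epsilon> p * \<epsilon> q else 0 else 0)"
    proof (intro sum.cong refl)
      fix a b
      show "evaluate (\<lambda>_. 0) (component (component p a * component q b) (\<lambda>_. 0)) =
          (if a = (\<lambda>_. 0) then if b = (\<lambda>_. 0) then \<epsilon> p * \<epsilon> q else 0 else 0)"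
        using invariant_product_zero[OF weight_component weight_component, of a b "\<lambda>_. 0" p q]
        by (auto simp: component_weight[OF weight_mult[OF weight_component weight_component]] \<epsilon>_def)
    qed
    also have "\<dots> = (\<Sum>a\<in>?A. if a = (\<lambda>_. 0) then (\<Sum>b\<in>?B. if b = (\<lambda>_. 0) then \<epsilon> p * \<epsilon> q else 0) else 0)"
      by (intro sum.cong refl) simp
    also have "\<dots> = \<epsilon> p * \<epsilon> q"
      using fin by (simp only: sum.delta insert_iff simp_thms if_True)
    finally show ?thesis .
  qed
  then have "algebra_hom (\<lambda>a. a) \<epsilon>"
    unfolding algebra_hom_def
    by (simp add: \<epsilon>_def component_add component_weight[OF weight_const])
  then have \<epsilon>: "\<epsilon> = evaluate (\<lambda>i. \<epsilon> (var i))" by (rule algebra_hom_eq_evaluate)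
  have "\<epsilon> (\<sigma> t p) = \<epsilon> p" if t: "t \<in> torus" for t p
  proof -
    let ?A = "{a. component p a \<noteq> 0}"
    have "\<sigma> t p = \<sigma> t (sum (component p) ?A)" using sum_component[of p] by simp
    also have "\<dots> = (\<Sum>a\<in>?A. const (chr t a) * component p a)"
      by (rule act_sum[OF weight_component t])
    finally have "component (\<sigma> t p) (\<lambda>_. 0) =
        (if (\<lambda>_. 0) \<in> ?A then const (chr t (\<lambda>_. 0)) * component p (\<lambda>_. 0) else 0)"
      by (rule component_eqI[OF finite_component weight_const_mult[OF weight_component]])
    then have "component (\<sigma> t p) (\<lambda>_. 0) = component p (\<lambda>_. 0)"
      by auto
    then show ?thesis by (simp add: \<epsilon>_def)
  qed
  then show ?thesis using \<epsilon> by metis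
qed

end

section \<open>Linearization at a fixed point\<close>

lemma algebra_automorphismI:
  assumes "algebra_hom const \<theta>" "algebra_hom const \<theta>'"
    and "\<And>i. \<theta> (\<theta>' (var i)) = var i" "\<And>i. \<theta>' (\<theta> (var i)) = var i"
  shows "algebra_automorphism \<theta>"
proof -
  have "\<theta> \<circ> \<theta>' = id" "\<theta>' \<circ> \<theta> = id"
    by (rule algebra_hom_eqI[OF algebra_hom_comp algebra_hom_id central_embedding_const];
      use assms in simp)+
  then show ?thesis
    using assms(1) by (auto simp: algebra_automorphism_iff intro: o_bij)
qed

lemma order_ge_1_iff: "order_ge 1 p \<longleftrightarrow> evaluate (\<lambda>_. 0) p = 0"
  by (auto simp: order_ge_def evaluate_zero letters_eq_iff)

lemma order_ge_2_iff:
  "order_ge 2 p \<longleftrightarrow> evaluate (\<lambda>_. 0) p = 0 \<and> (\<forall>j. Poly_Mapping.lookup p (Word [j]) = 0)"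
proof
  assume "order_ge 2 p"
  then show "evaluate (\<lambda>_. 0) p = 0 \<and> (\<forall>j. Poly_Mapping.lookup p (Word [j]) = 0)"
    by (simp add: order_ge_def evaluate_zero)
next
  assume *: "evaluate (\<lambda>_. 0) p = 0 \<and> (\<forall>j. Poly_Mapping.lookup p (Word [j]) = 0)"
  show "order_ge 2 p"
    unfolding order_ge_def
  proof (intro allI impI)
    fix w :: "'a free_monoid" assume "length (letters w) < 2"
    then have "letters w = [] \<or> (\<exists>j. letters w = [j])"
      by (cases "letters w") auto
    then show "Poly_Mapping.lookup p w = 0"
      using * by (auto simp: letters_eq_iff evaluate_zero)
  qed
qed

lemma sum_list_eq_sum_count:
  fixes f :: "'n::finite \<Rightarrow> int"
  shows "(\<Sum>i\<leftarrow>xs. f i) = (\<Sum>i\<in>UNIV. int (count_list xs i) * f i)"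
proof (induction xs)
  case (Cons x xs)
  have "(\<Sum>i\<in>UNIV. int (count_list (x # xs) i) * f i) =
      (\<Sum>i\<in>UNIV. (if i = x then f i else 0) + int (count_list xs i) * f i)"
    by (intro sum.cong) (auto simp: algebra_simps)
  then show ?case using Cons by (simp add: sum.distrib)
qed simp

text \<open>By independence the weight determines how often each letter occurs, and the length is
  the sum of these multiplicities.\<close>

lemma int_independent_length_eq:
  assumes "int_independent \<omega>" "(\<lambda>j. \<Sum>i\<leftarrow>xs. \<omega> i j) = (\<lambda>j. \<Sum>i\<leftarrow>ys. \<omega> i j)"
  shows "length xs = length ys"
proof -
  let ?m = "\<lambda>i. int (count_list xs i) - int (count_list ys i)"
  have "\<forall>j. (\<Sum>i\<in>UNIV. ?m i * \<omega> i j) = 0"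
    using fun_cong[OF assms(2)] by (simp add: sum_list_eq_sum_count left_diff_distrib sum_subtractf)
  then have "\<forall>i. ?m i = 0"
    using assms(1)[unfolded int_independent_def, THEN spec, of ?m] by simp
  then have "int (count_list xs i) * 1 = int (count_list ys i) * 1" for i by simp
  then have "(\<Sum>i\<leftarrow>xs. 1::int) = (\<Sum>i\<leftarrow>ys. 1)"
    by (simp only: sum_list_eq_sum_count)
  then show ?thesis by (simp add: sum_list_triv)
qed

context torus_action
begin

lemma component_diff: "component (p - q) a = component p a - component q a"
  using component_add[of "p - q" q a] by simp

context
  assumes fixed_origin: "\<And>t p. t \<in> torus \<Longrightarrow> evaluate (\<lambda>_. 0) (\<sigma> t p) = evaluate (\<lambda>_. 0) p"
begin

text \<open>Fixing the origin means that the images of the variables have no constant term. Hence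
  the torus preserves the filtration, and so do the projections to weight spaces.\<close>

lemma order_ge_act:
  assumes "t \<in> torus" "order_ge N p"
  shows "order_ge N (\<sigma> t p)"
  by (rule order_ge_hom[OF hom[OF assms(1)] _ assms(2)])
     (simp only: order_ge_1_iff fixed_origin[OF assms(1)] evaluate_var)

lemma order_ge_component:
  assumes "order_ge N p"
  shows "order_ge N (component p a)"
proof (cases "component p a = 0")
  case False
  show ?thesis
  proof (rule weight_components_order_ge[OF finite_component weight_component])
    show "order_ge N (\<sigma> t (sum (component p) {a. component p a \<noteq> 0}))" if "t \<in> torus" for t
      using order_ge_act[OF that assms] sum_component[of p] by simp
  qed (use False in simp)
qed simp

context
  fixes \<omega> y
  assumes weight_y: "\<And>i. weight \<sigma> (\<omega> i) (y i)"
    and tangent_y: "\<And>i. order_ge 2 (y i - var i)"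
begin

text \<open>An element at which all \<open>\<omega> i\<close> are trivial fixes every
  \<open>y i\<close>, hence moves \<open>var i\<close> only through the part
  \<open>y i - var i\<close> of order 2, and is therefore the identity.\<close>

lemma weights_independent: "int_independent \<omega>"
proof (rule int_independentI)
  fix l assume l: "\<forall>i. (\<Sum>j\<in>UNIV. l j * \<omega> i j) = 0"
  show "\<forall>j. l j = 0"
  proof (rule orthogonal_to_faithful_characters[OF infinite_field, of "range \<omega>"])
    fix t :: "'n \<Rightarrow> 'k" assume t: "t \<in> torus" "\<forall>a\<in>range \<omega>. chr t a = 1"
    show "t = (\<lambda>_. 1)"
    proof (rule trivial_to_first_order[OF t(1)])
      fix i
      have "\<sigma> t (y i) = y i" using weight_y t by (simp add: weight_def)
      then have "\<sigma> t (var i) - var i = (y i - var i) - \<sigma> t (y i - var i)"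
        by (simp add: algebra_homD[OF hom[OF t(1)]])
      then show "order_ge 2 (\<sigma> t (var i) - var i)"
        by (simp only:) (intro order_ge_diff order_ge_act t(1) tangent_y)
    qed
  qed (use l in auto)
qed

lemma substitute_order:
  "order_ge N p \<Longrightarrow> order_ge (Suc N) (substitute y p - p)"
  by (rule order_ge_hom_diff[OF algebra_hom_substitute]) (simp_all add: tangent_y)

text \<open>The substitution leaves the lowest-order part unchanged, so its kernel is zero.\<close>

lemma inj_substitute: "inj (substitute y)"
proof (rule injI)
  fix p q assume eq: "substitute y p = substitute y q"
  show "p = q"
  proof (rule ccontr)
    assume "p \<noteq> q"
    then have "p - q \<noteq> 0" by simp
    then obtain N where N: "order_ge N (p - q)" "\<not> order_ge (Suc N) (p - q)"
      by (rule obtain_order)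
    have "substitute y (p - q) = 0"
      using eq by (simp add: algebra_homD[OF algebra_hom_substitute])
    then have "order_ge (Suc N) (0 - (substitute y (p - q) - (p - q)))"
      by (intro order_ge_diff substitute_order N) simp
    then show False using N(2) \<open>substitute y (p - q) = 0\<close> by simp
  qed
qed

text \<open>Each word is sent to a weight vector, so projecting an image amounts to selecting words
  by weight. In particular the range is stable under the projections.\<close>

lemma component_substitute:
  "component (substitute y p) a = (\<Sum>w | w \<in> Poly_Mapping.keys p \<and> (\<lambda>j. \<Sum>i\<leftarrow>letters w. \<omega> i j) = a.
     substitute y (Poly_Mapping.single w (Poly_Mapping.lookup p w)))"
proof -
  have "component (substitute y p) a = (\<Sum>w\<in>Poly_Mapping.keys p.
      component (substitute y (Poly_Mapping.single w (Poly_Mapping.lookup p w))) a)"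
    by (simp add: substitute_def[of y p] substitute_single component_sum)
  also have "\<dots> = (\<Sum>w\<in>Poly_Mapping.keys p. if (\<lambda>j. \<Sum>i\<leftarrow>letters w. \<omega> i j) = a
      then substitute y (Poly_Mapping.single w (Poly_Mapping.lookup p w)) else 0)"
  proof (intro sum.cong refl)
    fix w
    have "weight \<sigma> (\<lambda>j. \<Sum>i\<leftarrow>letters w. \<omega> i j) (substitute y (Poly_Mapping.single w (Poly_Mapping.lookup p w)))"
      unfolding substitute_single by (intro weight_const_mult weight_prod_list weight_y)
    from component_weight[OF this, of a]
    show "component (substitute y (Poly_Mapping.single w (Poly_Mapping.lookup p w))) a =
        (if (\<lambda>j. \<Sum>i\<leftarrow>letters w. \<omega> i j) = a
         then substitute y (Poly_Mapping.single w (Poly_Mapping.lookup p w)) else 0)"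
      by auto
  qed
  also have "\<dots> = (\<Sum>w | w \<in> Poly_Mapping.keys p \<and> (\<lambda>j. \<Sum>i\<leftarrow>letters w. \<omega> i j) = a.
     substitute y (Poly_Mapping.single w (Poly_Mapping.lookup p w)))"
    by (simp add: sum.inter_filter)
  finally show ?thesis .
qed

lemma component_substitute_in_range: "component (substitute y p) a \<in> range (substitute y)"
  unfolding component_substitute
  by (simp only: algebra_hom_sum[OF algebra_hom_substitute, symmetric] rangeI)

text \<open>
  Since the weights are independent, the words of a given weight have the same length. Hence
  repeatedly subtracting from a weight vector the image of its part of that weight stops.
\<close>

lemma weight_in_range_substitute:
  assumes "weight \<sigma> a f"
  shows "f \<in> range (substitute y)"
proof -
  obtain L where L: "\<And>xs. (\<lambda>j. \<Sum>i\<leftarrow>xs. \<omega> i j) = a \<Longrightarrow> length xs \<le> L"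
  proof (cases "\<exists>ys. (\<lambda>j. \<Sum>i\<leftarrow>ys. \<omega> i j) = a")
    case True
    then obtain ys where "(\<lambda>j. \<Sum>i\<leftarrow>ys. \<omega> i j) = a" by blast
    then have "length xs \<le> length ys" if "(\<lambda>j. \<Sum>i\<leftarrow>xs. \<omega> i j) = a" for xs
      using int_independent_length_eq[OF weights_independent, of xs ys] that by simp
    then show ?thesis using that by blast
  qed (use that in blast)
  \<comment> \<open>A weight vector is its own component, and projecting
    \<open>f - substitute y f\<close>, which has order above \<open>M\<close>, does not lower the
    order.\<close>
  have step: "order_ge (Suc M) (f - component (substitute y f) a)"
    if "weight \<sigma> a f" "order_ge M f" for f M
  proof -
    have "f - component (substitute y f) a = component (0 - (substitute y f - f)) a"
      using component_weight[OF that(1), of a] by (simp add: component_diff)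
    then show ?thesis
      by (simp only:) (intro order_ge_component order_ge_diff order_ge_zero substitute_order that(2))
  qed
  \<comment> \<open>Beyond length \<open>L\<close> no word has weight \<open>a\<close>, so nothing
    is subtracted and the order of \<open>f\<close> rises without end.\<close>
  have zero: "f = 0" if f: "weight \<sigma> a f" "order_ge (Suc L) f" for f
  proof -
    have "component (substitute y f) a = 0"
      unfolding component_substitute
    proof (intro sum.neutral ballI, goal_cases)
      case (1 w)
      then have "length (letters w) \<le> L" "w \<in> Poly_Mapping.keys f" using L by auto
      then show ?case using f(2) by (auto simp: order_ge_def in_keys_iff)
    qed
    then have "order_ge M f \<Longrightarrow> order_ge (Suc M) f" for M
      using step[OF f(1), of M] by simp
    then have "order_ge M f" for M by (induction M) simp_all
    then show ?thesis by (rule order_ge_all_imp_0)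
  qed
  \<comment> \<open>Descending induction on the order: at \<open>Suc L\<close> only zero is left,
    and \<open>k = Suc L\<close> imposes no condition.\<close>
  have "weight \<sigma> a f \<Longrightarrow> order_ge (Suc L - k) f \<Longrightarrow> f \<in> range (substitute y)" for k f
  proof (induction k arbitrary: f)
    case 0
    then have "f = 0" using zero by simp
    then show ?case using algebra_homD(4)[OF algebra_hom_substitute, of y] by (metis rangeI)
  next
    case (Suc k)
    let ?r = "component (substitute y f) a"
    have "order_ge (Suc L - k) (f - ?r)"
      by (rule order_ge_mono[OF step[OF Suc.prems]]) simp
    then have "f - ?r \<in> range (substitute y)"
      by (intro Suc.IH weight_diff weight_component Suc.prems)
    then obtain q where q: "f - ?r = substitute y q" by blast
    obtain q' where q': "?r = substitute y q'" using component_substitute_in_range by blast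
    have "f = (f - ?r) + ?r" by simp
    also have "\<dots> = substitute y q + substitute y q'"
      by (rule arg_cong2[OF q q'])
    also have "\<dots> = substitute y (q + q')"
      by (simp only: algebra_homD[OF algebra_hom_substitute])
    finally show ?case by (metis rangeI)
  qed
  from this[OF assms, of "Suc L"] show ?thesis by simp
qed

lemma automorphism_substitute: "algebra_automorphism (substitute y)"
proof -
  have "p \<in> range (substitute y)" for p
  proof -
    have "\<forall>a. \<exists>q. component p a = substitute y q"
      using weight_in_range_substitute[OF weight_component] by blast
    then obtain q where "\<And>a. component p a = substitute y (q a)" by metis
    then have "p = substitute y (\<Sum>a | component p a \<noteq> 0. q a)"
      using sum_component[of p] by (simp add: algebra_hom_sum[OF algebra_hom_substitute])
    then show ?thesis by (metis rangeI)
  qed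
  then show ?thesis
    using inj_substitute by (auto simp: algebra_automorphism_iff algebra_hom_substitute bij_def)
qed

end

end

section \<open>Conjugate actions and the change to linear coordinates\<close>

lemma weight_conj_iff:
  assumes "algebra_automorphism \<theta>"
  shows "weight (\<lambda>t. \<theta> \<circ> \<sigma> t \<circ> inv \<theta>) a (\<theta> p) \<longleftrightarrow> weight \<sigma> a p"
proof -
  have b: "bij \<theta>" and h: "algebra_hom const \<theta>" using assms by (auto simp: algebra_automorphism_iff)
  have "\<theta> (\<sigma> t p) = const c * \<theta> p \<longleftrightarrow> \<sigma> t p = const c * p" for t c
    using bij_is_inj[OF b] by (simp add: algebra_hom_const_mult[OF h, symmetric] inj_eq)
  then show ?thesis
    using bij_is_inj[OF b] by (simp add: weight_def)
qed

lemma conjugate_action: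
  assumes "algebra_automorphism \<theta>"
  shows "torus_action (\<lambda>t. \<theta> \<circ> \<sigma> t \<circ> inv \<theta>)"
proof
  have b: "bij \<theta>" and h: "algebra_hom const \<theta>" using assms by (auto simp: algebra_automorphism_iff)
  show "infinite (UNIV :: 'k set)" by (rule infinite_field)
  show "algebra_automorphism (\<theta> \<circ> \<sigma> t \<circ> inv \<theta>)" if "t \<in> torus" for t
    by (intro algebra_automorphism_comp algebra_automorphism_inv assms aut that)
  show "\<exists>A f. finite A \<and> (\<forall>a\<in>A. weight (\<lambda>t. \<theta> \<circ> \<sigma> t \<circ> inv \<theta>) a (f a)) \<and> p = sum f A" for p
  proof -
    obtain A f where A: "finite A" "\<forall>a\<in>A. weight \<sigma> a (f a)" "inv \<theta> p = sum f A"
      using weights_span[of "inv \<theta> p"] by blast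
    have "p = \<theta> (inv \<theta> p)" using b by (simp add: bij_is_surj surj_f_inv_f)
    also have "\<dots> = (\<Sum>a\<in>A. \<theta> (f a))" by (simp add: A(3) algebra_hom_sum[OF h])
    finally show ?thesis
      using A(1,2) weight_conj_iff[OF assms] by (intro exI[of _ A] exI[of _ "\<lambda>a. \<theta> (f a)"]) simp
  qed
  show "t = (\<lambda>_. 1)" if t: "t \<in> torus" "\<theta> \<circ> \<sigma> t \<circ> inv \<theta> = id" for t
  proof (rule faithful[OF t(1)])
    have "\<theta> (\<sigma> t (inv \<theta> (\<theta> p))) = \<theta> p" for p
      using fun_cong[OF t(2), of "\<theta> p"] by simp
    then show "\<sigma> t = id"
      using bij_is_inj[OF b] by (auto simp: inj_eq)
  qed
qed

lemma linearization_conj: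
  assumes \<theta>: "algebra_automorphism \<theta>"
    and "\<exists>\<psi> \<omega>. algebra_automorphism \<psi> \<and> int_independent \<omega> \<and>
      (\<forall>i. weight (\<lambda>t. \<theta> \<circ> \<sigma> t \<circ> inv \<theta>) (\<omega> i) (\<psi> (var i)))"
  shows "\<exists>\<psi> \<omega>. algebra_automorphism \<psi> \<and> int_independent \<omega> \<and> (\<forall>i. weight \<sigma> (\<omega> i) (\<psi> (var i)))"
proof -
  obtain \<psi> \<omega> where \<psi>: "algebra_automorphism \<psi>" "int_independent \<omega>"
    "\<And>i. weight (\<lambda>t. \<theta> \<circ> \<sigma> t \<circ> inv \<theta>) (\<omega> i) (\<psi> (var i))"
    using assms(2) by blast
  have "surj \<theta>" using \<theta> by (auto simp: algebra_automorphism_iff bij_is_surj)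
  then have "\<psi> (var i) = \<theta> (inv \<theta> (\<psi> (var i)))" for i by (simp add: surj_f_inv_f)
  then have "weight \<sigma> (\<omega> i) (inv \<theta> (\<psi> (var i)))" for i
    using \<psi>(3)[of i] weight_conj_iff[OF \<theta>] by metis
  then show ?thesis
    using \<psi>(1,2) \<theta> algebra_automorphism_comp[OF algebra_automorphism_inv]
    by (intro exI[of _ "inv \<theta> \<circ> \<psi>"] exI[of _ \<omega>]) auto
qed

lemma linearizable_fixing_origin:
  assumes fixed: "\<And>t p. t \<in> torus \<Longrightarrow> evaluate (\<lambda>_. 0) (\<sigma> t p) = evaluate (\<lambda>_. 0) p"
  shows "\<exists>\<psi> \<omega>. algebra_automorphism \<psi> \<and> int_independent \<omega> \<and> (\<forall>i. weight \<sigma> (\<omega> i) (\<psi> (var i)))"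
proof -
  define lin :: "('n, 'k) free_algebra \<Rightarrow> 'k ^ 'n" where
    "lin p = (\<chi> j. Poly_Mapping.lookup p (Word [j]))" for p
  define S where "S = {lin p | p. \<exists>a. weight \<sigma> a p}"
  \<comment> \<open>The linear parts of weight vectors span because every variable is the sum of its
    components.\<close>
  have axis: "axis i 1 \<in> vec.span S" for i
  proof -
    have "axis i 1 = lin (var i)"
      by (auto simp: lin_def axis_def vec_eq_iff var_def lookup_single when_def)
    also have "\<dots> = lin (sum (component (var i)) {a. component (var i) a \<noteq> 0})"
      using sum_component[of "var i"] by simp
    also have "\<dots> = (\<Sum>a | component (var i) a \<noteq> 0. lin (component (var i) a))"
      by (simp add: lin_def vec_eq_iff lookup_sum)
    also have "\<dots> \<in> vec.span S"
      using weight_component by (intro vec.span_sum vec.span_base) (auto simp: S_def)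
    finally show ?thesis .
  qed
  have "v \<in> vec.span S" for v
  proof -
    have "(\<Sum>i\<in>UNIV. v $ i *s axis i 1) \<in> vec.span S"
      by (intro vec.span_sum vec.span_scale axis)
    then show ?thesis by (simp only: basis_expansion)
  qed
  then have "vec.span S = UNIV" by blast
  from spanning_set_invertible_matrix[OF this] obtain r :: "'n \<Rightarrow> 'k ^ 'n" and B
    where r: "\<forall>i. r i \<in> S" and B: "B ** (\<chi> i. r i) = mat 1" "(\<chi> i. r i) ** B = mat 1"
    by (elim exE conjE)
  have "\<forall>i. \<exists>p a. r i = lin p \<and> weight \<sigma> a p" using r by (auto simp: S_def)
  then obtain p \<omega> where p: "\<And>i. r i = lin (p i)" "\<And>i. weight \<sigma> (\<omega> i) (p i)" by metis
  define y where "y i = p i - const (evaluate (\<lambda>_. 0) (p i))" for i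
  \<comment> \<open>A weight vector that does not vanish at the fixed origin has weight zero, so
    removing its constant term keeps it a weight vector.\<close>
  have weight_y: "weight \<sigma> (\<omega> i) (y i)" for i
  proof (cases "evaluate (\<lambda>_. 0) (p i) = 0")
    case True
    then show ?thesis using p(2) by (simp add: y_def)
  next
    case False
    have "chr t (\<omega> i) = 1" if "t \<in> torus" for t :: "'n \<Rightarrow> 'k"
      using fixed[OF that, of "p i"] p(2)[of i] that False by (simp add: weight_def)
    then have "\<omega> i = (\<lambda>_. 0)"
      using chr_separates[OF infinite_field, of "\<omega> i" "\<lambda>_. 0"] by force
    then show ?thesis using p(2)[of i] weight_const by (simp add: y_def weight_diff)
  qed
  have y0: "evaluate (\<lambda>_. 0) (y i) = 0" for i by (simp add: y_def)
  have y1: "Poly_Mapping.lookup (y i) (Word [j]) = r i $ j" for i j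
    by (simp add: y_def p(1) lin_def lookup_minus lookup_const)
  define lsub :: "'k ^ 'n ^ 'n \<Rightarrow> ('n, 'k) free_algebra \<Rightarrow> ('n, 'k) free_algebra" where
    "lsub M = substitute (\<lambda>i. \<Sum>j\<in>UNIV. const (M $ i $ j) * var j)" for M
  have lsub_hom: "algebra_hom const (lsub M)" for M
    by (simp add: lsub_def algebra_hom_substitute)
  have lsub_comp: "lsub M (\<Sum>j\<in>UNIV. const (N $ i $ j) * var j) = (\<Sum>j\<in>UNIV. const ((N ** M) $ i $ j) * var j)" for M N i
  proof -
    have "lsub M (\<Sum>j\<in>UNIV. const (N $ i $ j) * var j) =
        (\<Sum>j\<in>UNIV. \<Sum>k\<in>UNIV. const (N $ i $ j * M $ j $ k) * var k)"
      by (simp add: algebra_hom_sum[OF lsub_hom] algebra_hom_const_mult[OF lsub_hom])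
         (simp add: lsub_def sum_distrib_left const_mult mult.assoc)
    also have "\<dots> = (\<Sum>k\<in>UNIV. const (\<Sum>j\<in>UNIV. N $ i $ j * M $ j $ k) * var k)"
      by (subst sum.swap) (simp add: sum_distrib_right const_sum)
    finally show ?thesis by (simp add: matrix_matrix_mult_def)
  qed
  have id: "(\<Sum>j\<in>UNIV. const ((mat 1 :: 'k ^ 'n ^ 'n) $ i $ j) * var j) = var i" for i
  proof -
    have "(\<Sum>j\<in>UNIV. const ((mat 1 :: 'k ^ 'n ^ 'n) $ i $ j) * var j) = (\<Sum>j\<in>UNIV. if j = i then var j else 0)"
      by (intro sum.cong) (auto simp: mat_def)
    then show ?thesis by simp
  qed
  \<comment> \<open>Since \<open>B\<close> inverts the matrix of linear parts,
    \<open>\<theta>\<close> sends the linear part of \<open>y i\<close> to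
    \<open>var i\<close>.\<close>
  define \<theta> where "\<theta> = lsub B"
  have \<theta>: "algebra_automorphism \<theta>"
  proof (rule algebra_automorphismI)
    show "algebra_hom const \<theta>" "algebra_hom const (lsub (\<chi> i. r i))"
      by (simp_all add: \<theta>_def lsub_hom)
    have lv: "lsub M (var i) = (\<Sum>j\<in>UNIV. const (M $ i $ j) * var j)" for M i
      by (simp add: lsub_def)
    show "\<theta> (lsub (\<chi> i. r i) (var i)) = var i" "lsub (\<chi> i. r i) (\<theta> (var i)) = var i" for i
      unfolding \<theta>_def lv lsub_comp B id by (rule refl)+
  qed
  have \<theta>_hom: "algebra_hom const \<theta>" by (simp add: \<theta>_def lsub_hom)
  have \<theta>_evaluate: "evaluate (\<lambda>_. 0) (\<theta> q) = evaluate (\<lambda>_. 0) q" for q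
  proof -
    have "evaluate (\<lambda>_. 0) \<circ> \<theta> = evaluate (\<lambda>_. 0)"
      by (rule algebra_hom_eqI[OF algebra_hom_comp[OF algebra_hom_evaluate \<theta>_hom] algebra_hom_evaluate])
         (simp_all add: \<theta>_def lsub_def evaluate_sum)
    then show ?thesis by (auto dest: fun_cong)
  qed
  interpret conjugate: torus_action "\<lambda>t. \<theta> \<circ> \<sigma> t \<circ> inv \<theta>" by (rule conjugate_action[OF \<theta>])
  have inv: "\<theta> (inv \<theta> q) = q" for q
    using \<theta> by (simp add: algebra_automorphism_iff bij_is_surj surj_f_inv_f)
  have fixed': "evaluate (\<lambda>_. 0) ((\<theta> \<circ> \<sigma> t \<circ> inv \<theta>) q) = evaluate (\<lambda>_. 0) q" if "t \<in> torus" for t q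
    using \<theta>_evaluate[of "inv \<theta> q"] by (simp add: \<theta>_evaluate fixed[OF that] inv)
  have weight': "weight (\<lambda>t. \<theta> \<circ> \<sigma> t \<circ> inv \<theta>) (\<omega> i) (\<theta> (y i))" for i
    using weight_y by (simp only: weight_conj_iff[OF \<theta>])
  have tangent': "order_ge 2 (\<theta> (y i) - var i)" for i
  proof -
    let ?l = "\<Sum>j\<in>UNIV. const ((\<chi> i. r i) $ i $ j) * var j"
    have "Poly_Mapping.lookup ?l (Word [j]) = (\<Sum>k\<in>UNIV. if k = j then r i $ j else 0)" for j
      unfolding lookup_sum by (intro sum.cong) (auto simp: var_def lookup_single when_def)
    then have "order_ge 2 (y i - ?l)"
      by (simp add: order_ge_2_iff y0 y1 lookup_minus evaluate_sum)
    have "order_ge 2 (\<theta> (y i - ?l))"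
    proof (rule order_ge_hom[OF \<theta>_hom])
      show "order_ge 1 (\<theta> (var j))" for j
        by (simp only: order_ge_1_iff \<theta>_evaluate evaluate_var)
    qed fact
    moreover have "\<theta> ?l = var i"
      unfolding \<theta>_def lsub_comp B id by (rule refl)
    ultimately show ?thesis by (simp only: algebra_homD[OF \<theta>_hom])
  qed
  show ?thesis
  proof (rule linearization_conj[OF \<theta>])
    show "\<exists>\<psi> \<omega>. algebra_automorphism \<psi> \<and> int_independent \<omega> \<and>
      (\<forall>i. weight (\<lambda>t. \<theta> \<circ> \<sigma> t \<circ> inv \<theta>) (\<omega> i) (\<psi> (var i)))"
      using conjugate.automorphism_substitute[OF fixed' weight' tangent']
        conjugate.weights_independent[OF fixed' weight' tangent'] weight'
      by (intro exI[of _ "substitute (\<lambda>i. \<theta> (y i))"] exI[of _ \<omega>]) simp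
  qed
qed

lemma linearizable:
  "\<exists>\<psi> \<omega>. algebra_automorphism \<psi> \<and> int_independent \<omega> \<and> (\<forall>i. weight \<sigma> (\<omega> i) (\<psi> (var i)))"
proof -
  obtain e where e: "\<forall>t\<in>torus. \<forall>p. evaluate e (\<sigma> t p) = evaluate e p" using fixed_point by blast
  \<comment> \<open>Evaluation at the origin after this translation is evaluation at
    \<open>e\<close>, so the conjugate action fixes the origin.\<close>
  define \<theta> :: "('n, 'k) free_algebra \<Rightarrow> ('n, 'k) free_algebra" where
    "\<theta> = substitute (\<lambda>i. var i + const (e i))"
  have \<theta>_hom: "algebra_hom const \<theta>" by (simp add: \<theta>_def algebra_hom_substitute)
  have \<theta>: "algebra_automorphism \<theta>"
  proof (rule algebra_automorphismI[OF \<theta>_hom algebra_hom_substitute])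
    show "\<theta> (substitute (\<lambda>i. var i - const (e i)) (var i)) = var i"
      "substitute (\<lambda>i. var i - const (e i)) (\<theta> (var i)) = var i" for i
      by (simp_all add: \<theta>_def algebra_homD[OF algebra_hom_substitute])
  qed
  have \<theta>_evaluate: "evaluate (\<lambda>_. 0) (\<theta> q) = evaluate e q" for q
  proof -
    have "evaluate (\<lambda>_. 0) \<circ> \<theta> = evaluate e"
      by (rule algebra_hom_eqI[OF algebra_hom_comp[OF algebra_hom_evaluate \<theta>_hom] algebra_hom_evaluate])
         (simp_all add: \<theta>_def)
    then show ?thesis by (auto dest: fun_cong)
  qed
  interpret conjugate: torus_action "\<lambda>t. \<theta> \<circ> \<sigma> t \<circ> inv \<theta>" by (rule conjugate_action[OF \<theta>])
  have inv: "\<theta> (inv \<theta> q) = q" for q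
    using \<theta> by (simp add: algebra_automorphism_iff bij_is_surj surj_f_inv_f)
  have "evaluate (\<lambda>_. 0) ((\<theta> \<circ> \<sigma> t \<circ> inv \<theta>) q) = evaluate (\<lambda>_. 0) q" if "t \<in> torus" for t q
    using \<theta>_evaluate[of "inv \<theta> q"] e that by (simp add: \<theta>_evaluate inv)
  from linearization_conj[OF \<theta> conjugate.linearizable_fixing_origin[OF this]] show ?thesis .
qed

end

section \<open>Scheme-theoretic effectiveness\<close>

text \<open>One pairing with two uses: against \<open>chr t\<close> it evaluates the Laurent
  polynomial with coefficients \<open>c\<close>, against an indicator function it sums the
  coefficients over a set of exponents.\<close>

definition lincomb :: "(('x \<Rightarrow> 'k::field) \<Rightarrow> ('x \<Rightarrow>\<^sub>0 'k) \<Rightarrow> 'k)" where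
  "lincomb g c = (\<Sum>a\<in>Poly_Mapping.keys c. Poly_Mapping.lookup c a * g a)"

lemma lincomb_superset:
  assumes "finite A" "Poly_Mapping.keys c \<subseteq> A"
  shows "lincomb g c = (\<Sum>a\<in>A. Poly_Mapping.lookup c a * g a)"
  unfolding lincomb_def using assms by (intro sum.mono_neutral_left) (auto simp: in_keys_iff)

lemma lincomb_add: "lincomb g (c + d) = lincomb g c + lincomb g d"
proof -
  let ?A = "Poly_Mapping.keys c \<union> Poly_Mapping.keys d"
  have "Poly_Mapping.keys (c + d) \<subseteq> ?A" by (rule keys_add)
  then show ?thesis
    by (simp add: lincomb_superset[of ?A] lookup_add distrib_right sum.distrib)
qed

lemma lincomb_zero [simp]: "lincomb g 0 = 0"
  by (simp add: lincomb_def)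

lemma lincomb_single [simp]: "lincomb g (Poly_Mapping.single a k) = k * g a"
  by (simp add: lincomb_superset[of "{a}"])

lemma lincomb_diff: "lincomb g (c - d) = lincomb g c - lincomb g d"
  using lincomb_add[of g "c - d" d] by simp

lemma lincomb_chr_eqI:
  assumes "infinite (UNIV :: 'k::field set)"
    and "\<And>t :: 'n::finite \<Rightarrow> 'k. t \<in> torus \<Longrightarrow> lincomb (chr t) c = lincomb (chr t) d"
  shows "c = d"
proof (rule ccontr)
  assume "c \<noteq> d"
  then obtain a where "Poly_Mapping.lookup c a \<noteq> Poly_Mapping.lookup d a"
    by (auto simp: poly_mapping_eq_iff fun_eq_iff)
  then have "a \<in> Poly_Mapping.keys (c - d)" by (simp add: in_keys_iff lookup_minus)
  moreover have "(\<Sum>a\<in>Poly_Mapping.keys (c - d). Poly_Mapping.lookup (c - d) a * chr t a) = 0"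
    if "t \<in> torus" for t :: "'n \<Rightarrow> 'k"
    using assms(2)[OF that] lincomb_diff[of "chr t" c d] by (simp add: lincomb_def)
  ultimately have "Poly_Mapping.lookup (c - d) a = 0"
    using chr_independent[OF assms(1) finite_keys] by blast
  then show False using \<open>a \<in> Poly_Mapping.keys (c - d)\<close> by (simp add: in_keys_iff)
qed

text \<open>
  The Laurent polynomials whose coefficients over \<open>L\<close> sum to zero. For a subgroup \<open>L\<close> they contain
  the ideal generated by all \<open>t ^ a - 1\<close> with \<open>a\<close> in \<open>L\<close>.
\<close>

definition coset_sum_zero :: "('n::finite \<Rightarrow> int) set \<Rightarrow> (('n \<Rightarrow> 'k::field) \<Rightarrow> 'k) \<Rightarrow> bool" where
  "coset_sum_zero L f \<longleftrightarrow> (\<exists>c. (\<forall>t\<in>torus. f t = lincomb (chr t) c) \<and>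
     lincomb (\<lambda>a. if a \<in> L then 1 else (0::'k)) c = 0)"

lemma coset_sum_zero_sum:
  fixes f :: "'x \<Rightarrow> ('n::finite \<Rightarrow> 'k::field) \<Rightarrow> 'k"
  assumes "finite I" "\<And>x. x \<in> I \<Longrightarrow> coset_sum_zero L (f x)"
  shows "coset_sum_zero L (\<lambda>t. \<Sum>x\<in>I. f x t)"
  using assms
proof (induction I rule: finite_induct)
  case empty
  show ?case unfolding coset_sum_zero_def by (intro exI[of _ 0]) simp
next
  case (insert x I)
  obtain c where c: "\<forall>t\<in>torus. f x t = lincomb (chr t) c"
    "lincomb (\<lambda>a. if a \<in> L then 1 else (0::'k)) c = 0"
    using insert.prems[of x] unfolding coset_sum_zero_def by auto
  have "coset_sum_zero L (\<lambda>t. \<Sum>x\<in>I. f x t)" using insert by blast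
  then obtain d where d: "\<forall>t\<in>torus. (\<Sum>x\<in>I. f x t) = lincomb (chr t) d"
    "lincomb (\<lambda>a. if a \<in> L then 1 else (0::'k)) d = 0"
    unfolding coset_sum_zero_def by auto
  show ?case
    unfolding coset_sum_zero_def using c d insert(1,2)
    by (intro exI[of _ "c + d"]) (simp add: lincomb_add)
qed

text \<open>The exponents \<open>b + a\<close> and \<open>b\<close> lie both in \<open>L\<close> or
  both outside, so their opposite coefficients cancel in the sum over \<open>L\<close>.\<close>

lemma coset_sum_zero_generator:
  assumes "\<And>b. (\<lambda>i. b i + a i) \<in> L \<longleftrightarrow> b \<in> L"
  shows "coset_sum_zero L (\<lambda>t. k * (chr t b * (chr t a - 1)))"
  unfolding coset_sum_zero_def
  by (intro exI[of _ "Poly_Mapping.single (\<lambda>i. b i + a i) k - Poly_Mapping.single b k"])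
     (simp add: lincomb_diff chr_add assms right_diff_distrib)

text \<open>Over an infinite field the coefficients are forced: 1 at \<open>a\<close> and -1 at
  zero. As zero lies in \<open>L\<close>, the sum over \<open>L\<close> vanishes only if
  \<open>a\<close> does too.\<close>

lemma coset_sum_zero_imp_mem:
  fixes L :: "('n::finite \<Rightarrow> int) set"
  assumes "infinite (UNIV :: 'k::field set)" "coset_sum_zero L (\<lambda>t :: 'n \<Rightarrow> 'k. chr t a - 1)"
    and "(\<lambda>_. 0) \<in> L"
  shows "a \<in> L"
proof -
  obtain c where c: "\<forall>t::'n \<Rightarrow> 'k\<in>torus. chr t a - 1 = lincomb (chr t) c"
    "lincomb (\<lambda>a. if a \<in> L then 1 else (0::'k)) c = 0"
    using assms(2) unfolding coset_sum_zero_def by blast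
  have "c = Poly_Mapping.single a 1 - Poly_Mapping.single (\<lambda>_. 0) 1"
  proof (rule lincomb_chr_eqI[OF assms(1)])
    fix t :: "'n \<Rightarrow> 'k" assume "t \<in> torus"
    then show "lincomb (chr t) c = lincomb (chr t) (Poly_Mapping.single a 1 - Poly_Mapping.single (\<lambda>_. 0) 1)"
      using c(1) by (simp add: lincomb_diff)
  qed
  then show ?thesis
    using c(2) assms(3) by (simp add: lincomb_diff split: if_splits)
qed

section \<open>Monomial endomorphisms of the torus\<close>

lemma torus_endomorphism_chr:
  "torus_endomorphism (\<lambda>(t :: 'n::finite \<Rightarrow> 'k::field) i. chr t (\<omega> i))"
  unfolding torus_endomorphism_def
proof (intro conjI ballI allI)
  show "(\<lambda>i. chr t (\<omega> i)) \<in> torus" if "t \<in> torus" for t :: "'n \<Rightarrow> 'k"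
    using chr_nonzero[OF that] by (simp add: torus_def)
  show "(\<lambda>i. chr (\<lambda>i. s i * t i) (\<omega> i)) = (\<lambda>i. chr s (\<omega> i) * chr t (\<omega> i))" for s t :: "'n \<Rightarrow> 'k"
    by (simp add: chr_mult)
  show "regular (\<lambda>t :: 'n \<Rightarrow> 'k. chr t (\<omega> i))" for i
    unfolding regular_def
    by (intro exI[of _ "{\<omega> i}"] exI[of _ "\<lambda>_. 1"]) (simp add: chr_def)
qed

lemma chr_chr:
  assumes "t \<in> torus"
  shows "chr (\<lambda>i. chr t (\<omega> i)) b = chr t (\<lambda>k. \<Sum>i\<in>UNIV. b i * \<omega> i k)"
  using assms by (simp add: chr_sum chr_powi) (simp add: chr_def)

lemma chr_unit [simp]: "chr t (\<lambda>i. if i = j then 1 else 0) = t j"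
proof -
  have "chr t (\<lambda>i. if i = j then 1 else 0) = (\<Prod>i\<in>UNIV. if i = j then t i else 1)"
    unfolding chr_def by (intro prod.cong) auto
  then show ?thesis by simp
qed

lemma torus_automorphism_chr:
  fixes \<omega> :: "'n::finite \<Rightarrow> 'n \<Rightarrow> int"
  assumes "int_independent \<omega>"
    and m: "\<And>j k. (\<Sum>i\<in>UNIV. m j i * \<omega> i k) = (if k = j then 1 else 0)"
  shows "torus_automorphism (\<lambda>(t :: 'n \<Rightarrow> 'k::field) i. chr t (\<omega> i))"
  unfolding torus_automorphism_def
proof (intro conjI exI[of _ "\<lambda>t i. chr t (m i)"] torus_endomorphism_chr ballI)
  fix t :: "'n \<Rightarrow> 'k" assume t: "t \<in> torus"
  show "(\<lambda>j. chr (\<lambda>i. chr t (\<omega> i)) (m j)) = t"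
    by (simp add: chr_chr[OF t] m)
  have "(\<Sum>j\<in>UNIV. \<omega> i j * m j k) = (if k = i then 1 else 0)" for i k
  proof -
    \<comment> \<open>These are the entries of row \<open>i\<close> of
      \<open>\<omega> m - 1\<close>. Since \<open>m \<omega> = 1\<close>, multiplying
      \<open>\<omega> m - 1\<close> by \<open>\<omega>\<close> on the right gives zero, and
      independence of the rows of \<open>\<omega>\<close> makes the integral left inverse a right
      inverse.\<close>
    let ?d = "\<lambda>k. (\<Sum>j\<in>UNIV. \<omega> i j * m j k) - (if k = i then 1 else 0)"
    have "(\<Sum>k\<in>UNIV. ?d k * \<omega> k l) = 0" for l
    proof -
      have "(\<Sum>k\<in>UNIV. (\<Sum>j\<in>UNIV. \<omega> i j * m j k) * \<omega> k l) =
          (\<Sum>j\<in>UNIV. \<omega> i j * (\<Sum>k\<in>UNIV. m j k * \<omega> k l))"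
        unfolding sum_distrib_right sum_distrib_left mult.assoc by (rule sum.swap)
      also have "\<dots> = (\<Sum>j\<in>UNIV. if j = l then \<omega> i j else 0)"
        unfolding m by (intro sum.cong) auto
      finally have "(\<Sum>k\<in>UNIV. (\<Sum>j\<in>UNIV. \<omega> i j * m j k) * \<omega> k l) = \<omega> i l" by simp
      moreover have "(\<Sum>k\<in>UNIV. (if k = i then 1 else 0) * \<omega> k l) = (\<Sum>k\<in>UNIV. if k = i then \<omega> k l else 0)"
        by (intro sum.cong) auto
      ultimately show ?thesis by (simp add: left_diff_distrib sum_subtractf)
    qed
    then have "\<forall>k. ?d k = 0"
      using assms(1)[unfolded int_independent_def, THEN spec, of ?d] by blast
    then show ?thesis by simp
  qed
  then show "(\<lambda>i. chr (\<lambda>j. chr t (m j)) (\<omega> i)) = t"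
    by (simp add: chr_chr[OF t])
qed

text \<open>Expand \<open>\<sigma> t p\<close> in characters of \<open>t\<close>, with coefficients
  \<open>f a\<close> in the algebra. Comparing \<open>\<sigma> s (\<sigma> t p)\<close> with the
  expansion at \<open>s t\<close> as combinations of characters of \<open>t\<close> shows that
  \<open>f a\<close> has weight \<open>a\<close>, and \<open>t = 1\<close> gives \<open>p\<close> as
  their sum.\<close>

lemma torus_action_of_algebraic:
  fixes \<sigma> :: "('n::finite \<Rightarrow> 'k::field) \<Rightarrow> ('n, 'k) free_algebra \<Rightarrow> ('n, 'k) free_algebra"
  assumes inf: "infinite (UNIV :: 'k set)" and alg: "algebraic_torus_action \<sigma>" and eff: "effective \<sigma>"
  shows "torus_action \<sigma>"
proof
  show "infinite (UNIV :: 'k set)" by (rule inf)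
  show "t = (\<lambda>_. 1)" if "t \<in> torus" "\<sigma> t = id" for t
    using eff that by (simp add: effective_def)
  show aut: "algebra_automorphism (\<sigma> t)" if "t \<in> torus" for t
    using alg that by (simp add: algebraic_torus_action_def)
  fix p
  have hom: "algebra_hom const (\<sigma> t)" if "t \<in> torus" for t
    using aut[OF that] by (simp add: algebra_automorphism_iff)
  obtain W where W: "finite W" "\<And>t. t \<in> torus \<Longrightarrow> Poly_Mapping.keys (\<sigma> t p) \<subseteq> W"
    "\<And>w. w \<in> W \<Longrightarrow> regular (\<lambda>t. Poly_Mapping.lookup (\<sigma> t p) w)"
    using alg unfolding algebraic_torus_action_def by meson
  have "\<forall>w\<in>W. \<exists>A c. finite A \<and>
      (\<forall>t\<in>torus. Poly_Mapping.lookup (\<sigma> t p) w = (\<Sum>a\<in>A. c a * chr t a))"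
    using W(3) unfolding regular_def chr_def by blast
  then obtain A c where A: "\<And>w. w \<in> W \<Longrightarrow> finite (A w)"
    "\<And>w t. w \<in> W \<Longrightarrow> t \<in> torus \<Longrightarrow> Poly_Mapping.lookup (\<sigma> t p) w = (\<Sum>a\<in>A w. c w a * chr t a)"
    by metis
  define B where "B = (\<Union>w\<in>W. A w)"
  have B: "finite B" using W(1) A(1) by (simp add: B_def)
  \<comment> \<open>Outside \<open>A w\<close> the coefficients \<open>c w\<close> are
    unconstrained; setting them to zero lets all words share the exponent set
    \<open>B\<close>.\<close>
  define f where "f a = (\<Sum>w\<in>W. Poly_Mapping.single w (if a \<in> A w then c w a else 0))" for a
  have lookup_f: "Poly_Mapping.lookup (f a) v = (if v \<in> W \<and> a \<in> A v then c v a else 0)" for a v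
  proof -
    have "Poly_Mapping.lookup (f a) v = (\<Sum>w\<in>W. if w = v then (if a \<in> A v then c v a else 0) else 0)"
      unfolding f_def lookup_sum by (intro sum.cong) (auto simp: lookup_single when_def)
    then show ?thesis using W(1) by simp
  qed
  have dec: "\<sigma> t p = (\<Sum>a\<in>B. const (chr t a) * f a)" if t: "t \<in> torus" for t
  proof (rule poly_mapping_eqI)
    fix v
    have "Poly_Mapping.lookup (\<Sum>a\<in>B. const (chr t a) * f a) v =
        (\<Sum>a\<in>B. chr t a * (if v \<in> W \<and> a \<in> A v then c v a else 0))"
      by (simp add: lookup_sum lookup_f)
    also have "\<dots> = Poly_Mapping.lookup (\<sigma> t p) v"
    proof (cases "v \<in> W")
      case True
      have "(\<Sum>a\<in>B. chr t a * (if v \<in> W \<and> a \<in> A v then c v a else 0)) = (\<Sum>a\<in>A v. c v a * chr t a)"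
        using True B by (intro sum.mono_neutral_cong_right) (auto simp: B_def)
      then show ?thesis using A(2)[OF True t] by simp
    next
      case False
      then show ?thesis using W(2)[OF t] by (auto simp: in_keys_iff)
    qed
    finally show "Poly_Mapping.lookup (\<sigma> t p) v = Poly_Mapping.lookup (\<Sum>a\<in>B. const (chr t a) * f a) v"
      by simp
  qed
  have "weight \<sigma> a (f a)" if a: "a \<in> B" for a
    unfolding weight_def
  proof
    fix s :: "'n \<Rightarrow> 'k" assume s: "s \<in> torus"
    show "\<sigma> s (f a) = const (chr s a) * f a"
    proof (rule poly_mapping_eqI)
      fix v
      let ?X = "\<lambda>a. Poly_Mapping.lookup (\<sigma> s (f a)) v - chr s a * Poly_Mapping.lookup (f a) v"
      have "(\<Sum>a\<in>B. ?X a * chr t a) = 0" if t: "t \<in> torus" for t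
      proof -
        have "\<sigma> s (\<sigma> t p) = \<sigma> (\<lambda>i. s i * t i) p"
          using alg s t by (simp add: algebraic_torus_action_def)
        then have "(\<Sum>a\<in>B. const (chr t a) * \<sigma> s (f a)) = (\<Sum>a\<in>B. const (chr s a * chr t a) * f a)"
          by (simp add: dec[OF t] dec[OF torus_mult[OF s t]] chr_mult
            algebra_hom_sum[OF hom[OF s]] algebra_hom_const_mult[OF hom[OF s]])
        then have "(\<Sum>a\<in>B. chr t a * Poly_Mapping.lookup (\<sigma> s (f a)) v) =
            (\<Sum>a\<in>B. chr s a * chr t a * Poly_Mapping.lookup (f a) v)"
          by (auto simp: lookup_sum dest: arg_cong[of _ _ "\<lambda>q. Poly_Mapping.lookup q v"])
        then show ?thesis by (simp add: algebra_simps sum_subtractf)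
      qed
      from chr_independent[OF inf B this a]
      show "Poly_Mapping.lookup (\<sigma> s (f a)) v = Poly_Mapping.lookup (const (chr s a) * f a) v"
        by simp
    qed
  qed
  moreover have "p = sum f B"
    using dec[OF torus_one] alg by (simp add: algebraic_torus_action_def)
  ultimately show "\<exists>A f. finite A \<and> (\<forall>a\<in>A. weight \<sigma> a (f a)) \<and> p = sum f A"
    using B by blast
qed

context torus_action
begin

text \<open>All weights that occur lie in the group \<open>L\<close> generated by the
  \<open>\<omega> i\<close>, so the ideal of the kernel is contained in the one generated by the
  functions \<open>t ^ a - 1\<close> with \<open>a\<close> in \<open>L\<close>. That it contains
  \<open>t j - 1\<close> forces the \<open>j\<close>-th unit vector into \<open>L\<close>.\<close>

lemma scheme_effective_imp_generate:
  assumes \<psi>: "algebra_automorphism \<psi>" and weight: "\<And>i. weight \<sigma> (\<omega> i) (\<psi> (var i))"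
    and "scheme_effective \<sigma>"
  shows "\<exists>m. \<forall>k. (\<Sum>i\<in>UNIV. m i * \<omega> i k) = (if k = j then 1 else 0)"
proof -
  define L where "L = {b. \<exists>m. \<forall>k. (\<Sum>i\<in>UNIV. m i * \<omega> i k) = b k}"
  have L_add: "(\<lambda>i. b i + a i) \<in> L" if "b \<in> L" "a \<in> L" for a b
  proof -
    obtain m m' where "\<forall>k. (\<Sum>i\<in>UNIV. m i * \<omega> i k) = b k" "\<forall>k. (\<Sum>i\<in>UNIV. m' i * \<omega> i k) = a k"
      using \<open>b \<in> L\<close> \<open>a \<in> L\<close> by (auto simp: L_def)
    then show ?thesis
      unfolding L_def by (auto intro!: exI[of _ "\<lambda>i. m i + m' i"] simp: distrib_right sum.distrib)
  qed
  have L_uminus: "(\<lambda>i. - a i) \<in> L" if "a \<in> L" for a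
  proof -
    obtain m where "\<forall>k. (\<Sum>i\<in>UNIV. m i * \<omega> i k) = a k"
      using \<open>a \<in> L\<close> by (auto simp: L_def)
    then show ?thesis
      unfolding L_def by (auto intro!: exI[of _ "\<lambda>i. - m i"] simp: sum_negf)
  qed
  have L_coset: "(\<lambda>i. b i + a i) \<in> L \<longleftrightarrow> b \<in> L" if "a \<in> L" for a b
    using L_add[OF _ that, of b] L_add[OF _ L_uminus[OF that], of "\<lambda>i. b i + a i"] by auto
  have L_zero: "(\<lambda>_. 0) \<in> L"
    unfolding L_def by (auto intro!: exI[of _ "\<lambda>_. 0"])
  have L_word: "(\<lambda>j. \<Sum>i\<leftarrow>xs. \<omega> i j) \<in> L" for xs
    unfolding L_def sum_list_eq_sum_count by auto
  have \<psi>_hom: "algebra_hom const \<psi>" and "surj \<psi>"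
    using \<psi> by (auto simp: algebra_automorphism_iff bij_is_surj)
  have gen: "coset_sum_zero L (\<lambda>t. h t * (Poly_Mapping.lookup (\<sigma> t (var i)) w - Poly_Mapping.lookup (var i) w))"
    if "regular h" for h i w
  proof -
    \<comment> \<open>Written in the coordinates \<open>\<psi> (var i)\<close>, the variable is a
      combination of weight vectors, which turns the coefficient difference into a combination of
      functions \<open>t ^ a - 1\<close> with \<open>a\<close> in \<open>L\<close>.\<close>
    define q where "q = inv \<psi> (var i)"
    let ?W = "\<lambda>v. \<lambda>j. \<Sum>i\<leftarrow>letters v. \<omega> i j"
    let ?y = "\<lambda>v. prod_list (map (\<lambda>i. \<psi> (var i)) (letters v))"
    have var_eq: "var i = (\<Sum>v\<in>Poly_Mapping.keys q. const (Poly_Mapping.lookup q v) * ?y v)"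
      using algebra_hom_expand[OF \<psi>_hom, of q] \<open>surj \<psi>\<close> by (simp add: q_def surj_f_inv_f)
    have diff: "Poly_Mapping.lookup (\<sigma> t (var i)) w - Poly_Mapping.lookup (var i) w =
        (\<Sum>v\<in>Poly_Mapping.keys q. Poly_Mapping.lookup q v * Poly_Mapping.lookup (?y v) w * (chr t (?W v) - 1))"
      if t: "t \<in> torus" for t
    proof -
      have "\<sigma> t (?y v) = const (chr t (?W v)) * ?y v" for v
        using weight_prod_list[of \<omega> "\<lambda>i. \<psi> (var i)" "letters v"] weight t by (simp add: weight_def)
      then have "\<sigma> t (var i) = (\<Sum>v\<in>Poly_Mapping.keys q. const (Poly_Mapping.lookup q v) * (const (chr t (?W v)) * ?y v))"
        by (subst var_eq) (simp add: algebra_hom_sum[OF hom[OF t]] algebra_hom_const_mult[OF hom[OF t]])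
      moreover have "Poly_Mapping.lookup (var i) w =
          (\<Sum>v\<in>Poly_Mapping.keys q. Poly_Mapping.lookup q v * Poly_Mapping.lookup (?y v) w)"
        by (subst var_eq) (simp add: lookup_sum)
      ultimately show ?thesis
        by (simp add: lookup_sum algebra_simps sum_subtractf)
    qed
    obtain A c where A: "finite A" "\<forall>t\<in>torus. h t = (\<Sum>a\<in>A. c a * chr t a)"
      using \<open>regular h\<close> unfolding regular_def chr_def by blast
    have "coset_sum_zero L (\<lambda>t. \<Sum>a\<in>A. \<Sum>v\<in>Poly_Mapping.keys q.
        (c a * Poly_Mapping.lookup q v * Poly_Mapping.lookup (?y v) w) * (chr t a * (chr t (?W v) - 1)))"
      using A(1) by (intro coset_sum_zero_sum coset_sum_zero_generator L_coset L_word finite_keys)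
    moreover have "h t * (Poly_Mapping.lookup (\<sigma> t (var i)) w - Poly_Mapping.lookup (var i) w) =
        (\<Sum>a\<in>A. \<Sum>v\<in>Poly_Mapping.keys q.
        (c a * Poly_Mapping.lookup q v * Poly_Mapping.lookup (?y v) w) * (chr t a * (chr t (?W v) - 1)))"
      if "t \<in> torus" for t
      unfolding diff[OF that] using A(2) that by (simp add: sum_product mult_ac)
    ultimately show ?thesis
      unfolding coset_sum_zero_def by simp
  qed
  from assms(3)[unfolded scheme_effective_def, THEN spec, of j]
  obtain S h where S: "finite S" "\<forall>i w. regular (h i w)"
    "\<forall>t\<in>torus. t j - 1 = (\<Sum>(i, w)\<in>S. h i w t *
      (Poly_Mapping.lookup (\<sigma> t (var i)) w - Poly_Mapping.lookup (var i) w))"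
    by (elim exE conjE)
  let ?e = "\<lambda>k. if k = j then 1 else (0::int)"
  have "coset_sum_zero L (\<lambda>t. \<Sum>x\<in>S. h (fst x) (snd x) t *
      (Poly_Mapping.lookup (\<sigma> t (var (fst x))) (snd x) - Poly_Mapping.lookup (var (fst x)) (snd x)))"
    using S(1) by (intro coset_sum_zero_sum gen S(2)[rule_format])
  then have "coset_sum_zero L (\<lambda>t :: 'n \<Rightarrow> 'k. chr t ?e - 1)"
    using S(3) unfolding coset_sum_zero_def by (simp add: case_prod_unfold)
  then have "?e \<in> L"
    by (rule coset_sum_zero_imp_mem[OF infinite_field _ L_zero])
  then show ?thesis by (simp add: L_def)
qed

end

theorem theorem3p8:
  fixes \<sigma> :: "('n::finite \<Rightarrow> 'k::field) \<Rightarrow> ('n, 'k) free_algebra \<Rightarrow> ('n, 'k) free_algebra"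
  assumes "infinite (UNIV :: 'k set)"
    and "algebraic_torus_action \<sigma>"
    and "effective \<sigma>"
  shows "\<exists>\<phi> \<tau>. algebra_automorphism \<phi> \<and>
           torus_endomorphism \<tau> \<and> inj_on \<tau> torus \<and>
           (scheme_effective \<sigma> \<longrightarrow> torus_automorphism \<tau>) \<and>
           (\<forall>t\<in>torus. \<phi> \<circ> \<sigma> t = standard_action (\<tau> t) \<circ> \<phi>)"
proof -
  interpret torus_action \<sigma> by (rule torus_action_of_algebraic[OF assms])
  obtain \<psi> \<omega> where \<psi>: "algebra_automorphism \<psi>" and \<omega>: "int_independent \<omega>"
    and weight: "\<And>i. weight \<sigma> (\<omega> i) (\<psi> (var i))"
    using linearizable by blast
  have \<psi>_hom: "algebra_hom const \<psi>" and "bij \<psi>"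
    using \<psi> by (auto simp: algebra_automorphism_iff)
  define \<phi> where "\<phi> = inv \<psi>"
  define \<tau> :: "('n \<Rightarrow> 'k) \<Rightarrow> 'n \<Rightarrow> 'k" where "\<tau> = (\<lambda>t i. chr t (\<omega> i))"
  have \<phi>\<psi>: "\<phi> (\<psi> p) = p" "\<psi> (\<phi> p) = p" for p
    using \<open>bij \<psi>\<close> by (simp_all add: \<phi>_def bij_is_inj bij_is_surj surj_f_inv_f)
  have conj: "\<phi> \<circ> \<sigma> t = standard_action (\<tau> t) \<circ> \<phi>" if t: "t \<in> torus" for t
  proof -
    \<comment> \<open>Both sides are algebra homomorphisms, so this need only be checked on
      variables, where it says that \<open>\<psi> (var i)\<close> has weight
      \<open>\<omega> i\<close>.\<close>
    have "\<sigma> t \<circ> \<psi> = \<psi> \<circ> standard_action (\<tau> t)"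
    proof (rule algebra_hom_eqI[OF algebra_hom_comp algebra_hom_comp central_embedding_const])
      show "algebra_hom const (standard_action (\<tau> t))"
        by (simp add: standard_action_def algebra_hom_substitute)
      show "(\<sigma> t \<circ> \<psi>) (var i) = (\<psi> \<circ> standard_action (\<tau> t)) (var i)" for i
        using weight t
        by (simp add: standard_action_def weight_def algebra_hom_const_mult[OF \<psi>_hom] \<tau>_def)
    qed (simp_all add: hom[OF t] \<psi>_hom)
    then have "\<sigma> t (\<psi> (\<phi> p)) = \<psi> (standard_action (\<tau> t) (\<phi> p))" for p
      by (metis o_apply)
    then show ?thesis by (auto simp: \<phi>\<psi>)
  qed
  \<comment> \<open>Elements with equal twists act equally by the conjugacy, so effectiveness
    applies to their quotient.\<close>
  have "inj_on \<tau> torus"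
  proof (rule inj_onI)
    fix s t :: "'n \<Rightarrow> 'k" assume s: "s \<in> torus" and t: "t \<in> torus" and eq: "\<tau> s = \<tau> t"
    let ?u = "\<lambda>i. inverse (t i)"
    have u: "?u \<in> torus" using t by (simp add: torus_def)
    have "\<sigma> s p = \<sigma> t p" for p
      using conj[OF s] conj[OF t] eq \<phi>\<psi> by (metis o_apply)
    then have "\<sigma> (\<lambda>i. s i * ?u i) = \<sigma> (\<lambda>i. t i * ?u i)"
      using assms(2) s t u by (auto simp: algebraic_torus_action_def)
    moreover have "(\<lambda>i. t i * ?u i) = (\<lambda>i. 1)" using t by (simp add: torus_def)
    ultimately have "\<sigma> (\<lambda>i. s i * ?u i) = id"
      using assms(2) by (simp add: algebraic_torus_action_def)
    then have "(\<lambda>i. s i * ?u i) = (\<lambda>_. 1)" by (rule faithful[OF torus_mult[OF s u]])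
    then show "s = t"
      using t by (auto simp: fun_eq_iff torus_def field_simps)
  qed
  moreover have "torus_automorphism \<tau>" if "scheme_effective \<sigma>"
  proof -
    have "\<forall>j. \<exists>m. \<forall>k. (\<Sum>i\<in>UNIV. m i * \<omega> i k) = (if k = j then 1 else 0)"
      using scheme_effective_imp_generate[OF \<psi> weight that] by blast
    then obtain m where "\<And>j k. (\<Sum>i\<in>UNIV. m j i * \<omega> i k) = (if k = j then 1 else 0)" by metis
    then show ?thesis unfolding \<tau>_def by (rule torus_automorphism_chr[OF \<omega>])
  qed
  moreover have "algebra_automorphism \<phi>" unfolding \<phi>_def by (rule algebra_automorphism_inv[OF \<psi>])
  moreover have "torus_endomorphism \<tau>" unfolding \<tau>_def by (rule torus_endomorphism_chr)
  ultimately show ?thesis using conj by blast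
qed

end
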